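(* There is a universal constant $C\in(0,\infty)$ such that for every $\varepsilon\in(0,1/2)$ and every $n\in\mathbb{N}$ there exists $f_\varepsilon:\mathbb{H}_n\to\ell_2$ satisfying $$\sqrt{\varepsilon}\,d_{N_0}(x,y)^{1-\varepsilon}\le\|f_\varepsilon(x)-f_\varepsilon(y)\|\le d_{N_0}(x,y)^{1-\varepsilon}\qquad\text{for all }x,y\in\mathbb{H}_n,$$ and such that $f_\varepsilon(\mathbb{H}_n)$, with the metric inherited from $\ell_2$, is doubling with doubling constant at most $e^{Cn}$.
   Context: $\mathbb{N}=\{1,2,\dots\}$. For $n\in\mathbb{N}$ the $n$-th Heisenberg group $\mathbb{H}_n$ is $\mathbb{C}^n\times\mathbb{R}$ with the group product $(w,s)\cdot(z,t)=\left(w+z,\ s+t+2\sum_{j=1}^n\operatorname{Im}(w_j\overline{z_j})\right)$; its identity is $(0,0)$ and $(z,t)^{-1}=(-z,-t)$. The Koranyi norm is $N_0(z,t)=\sqrt[4]{|z|^4+t^2}$, where $|z|^2=\sum_{j=1}^n|z_j|^2$, and $d_{N_0}(g,h)=N_0(h^{-1}g)$, which is a left-invariant metric on $\mathbb{H}_n$. A metric space $(X,d)$ has doubling constant at most $K$ if every closed ball $B(x,r)$, $r>0$, can be covered by at most $K$ closed balls of radius $r/2$ centered at points of $X$. $\ell_2$ is infinite dimensional (real, separable) Hilbert space with norm $\|\cdot\|$. *)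

theory Defs
  imports "HOL-Analysis.Analysis" "HOL-Algebra.Group"
begin

section \<open>The Heisenberg groups\<close>

text \<open>The index \<open>n\<close> has to vary inside a statement, so \<open>\<complex>\<^sup>n\<close> is the set of sequences that vanish
  outside \<open>{1..n}\<close> instead of a type. Coordinates outside \<open>{1..n}\<close> are set to \<open>0\<close> so that each
  point has a unique representative.\<close>

definition heisenberg :: "nat \<Rightarrow> ((nat \<Rightarrow> complex) \<times> real) monoid" where
  "heisenberg n =
    \<lparr>carrier = {z. \<forall>j. j \<notin> {1..n} \<longrightarrow> z j = 0} \<times> UNIV,
     monoid.mult = (\<lambda>(w, s) (z, t).
       ((\<lambda>j. w j + z j), s + t + 2 * (\<Sum>j=1..n. Im (w j * cnj (z j))))),
     one = ((\<lambda>_. 0), 0)\<rparr>"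

lemma heisenberg_inverse_aux:
  assumes "(z, t) \<in> carrier (heisenberg n)"
  shows "((\<lambda>j. - z j), - t) \<in> carrier (heisenberg n)"
    and "((\<lambda>j. - z j), - t) \<otimes>\<^bsub>heisenberg n\<^esub> (z, t) = \<one>\<^bsub>heisenberg n\<^esub>"
  using assms by (auto simp: heisenberg_def)

lemma group_heisenberg: "group (heisenberg n)"
proof (rule groupI)
  fix x y z
  assume "x \<in> carrier (heisenberg n)" "y \<in> carrier (heisenberg n)" "z \<in> carrier (heisenberg n)"
  show "x \<otimes>\<^bsub>heisenberg n\<^esub> y \<otimes>\<^bsub>heisenberg n\<^esub> z = x \<otimes>\<^bsub>heisenberg n\<^esub> (y \<otimes>\<^bsub>heisenberg n\<^esub> z)"
    by (cases x; cases y; cases z)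
       (simp add: heisenberg_def algebra_simps sum.distrib sum_subtractf)
next
  fix x assume "x \<in> carrier (heisenberg n)"
  then show "\<exists>y\<in>carrier (heisenberg n). y \<otimes>\<^bsub>heisenberg n\<^esub> x = \<one>\<^bsub>heisenberg n\<^esub>"
    by (metis heisenberg_inverse_aux surj_pair)
qed (auto simp: heisenberg_def)

lemma inv_heisenberg:
  assumes "(z, t) \<in> carrier (heisenberg n)"
  shows "inv\<^bsub>heisenberg n\<^esub> (z, t) = ((\<lambda>j. - z j), - t)"
  using group.inv_equality[OF group_heisenberg heisenberg_inverse_aux(2)[OF assms] assms
      heisenberg_inverse_aux(1)[OF assms]] .

definition koranyi_norm :: "nat \<Rightarrow> (nat \<Rightarrow> complex) \<times> real \<Rightarrow> real" where
  "koranyi_norm n = (\<lambda>(z, t). root 4 (L2_set (\<lambda>j. cmod (z j)) {1..n} ^ 4 + t\<^sup>2))"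

definition koranyi_dist ::
    "nat \<Rightarrow> (nat \<Rightarrow> complex) \<times> real \<Rightarrow> (nat \<Rightarrow> complex) \<times> real \<Rightarrow> real" where
  "koranyi_dist n g h = koranyi_norm n (inv\<^bsub>heisenberg n\<^esub> h \<otimes>\<^bsub>heisenberg n\<^esub> g)"


section \<open>Doubling metric spaces\<close>

text \<open>\<^const>\<open>Metric_space.mcball\<close> is the closed ball of the space itself: both its centre and its
  points lie in \<open>M\<close>. The bound \<open>K\<close> is real because it need not be an integer.\<close>

definition (in Metric_space) doubling_constant_at_most :: "real \<Rightarrow> bool" where
  "doubling_constant_at_most K \<longleftrightarrow>
    (\<forall>x\<in>M. \<forall>r>0. \<exists>F\<subseteq>M. finite F \<and> real (card F) \<le> K \<and> mcball x r \<subseteq> (\<Union>y\<in>F. mcball y (r / 2)))"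


section \<open>The Hilbert space of square-summable real sequences\<close>

typedef ell2 = "{x :: nat \<Rightarrow> real. summable (\<lambda>k. (x k)\<^sup>2)}"
  morphisms ell2_nth Abs_ell2
  by (rule exI[of _ "\<lambda>_. 0"]) simp

setup_lifting type_definition_ell2

lemma summable_mult_square_summable:
  fixes x y :: "nat \<Rightarrow> real"
  assumes "summable (\<lambda>k. (x k)\<^sup>2)" "summable (\<lambda>k. (y k)\<^sup>2)"
  shows "summable (\<lambda>k. x k * y k)"
proof (rule summable_comparison_test'[OF summable_add[OF assms], of 0])
  fix k
  have "2 * (\<bar>x k\<bar> * \<bar>y k\<bar>) \<le> (x k)\<^sup>2 + (y k)\<^sup>2"
    using sum_squares_bound[of "\<bar>x k\<bar>" "\<bar>y k\<bar>"] by simp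
  moreover have "0 \<le> \<bar>x k\<bar> * \<bar>y k\<bar>" by simp
  ultimately show "norm (x k * y k) \<le> (x k)\<^sup>2 + (y k)\<^sup>2"
    unfolding real_norm_def abs_mult by linarith
qed

lemma summable_square_add:
  fixes x y :: "nat \<Rightarrow> real"
  assumes "summable (\<lambda>k. (x k)\<^sup>2)" "summable (\<lambda>k. (y k)\<^sup>2)"
  shows "summable (\<lambda>k. (x k + y k)\<^sup>2)"
  unfolding power2_sum mult.assoc
  by (intro summable_add summable_mult assms summable_mult_square_summable)

instantiation ell2 :: real_inner
begin

lift_definition zero_ell2 :: ell2 is "\<lambda>_. 0" by simp

lift_definition plus_ell2 :: "ell2 \<Rightarrow> ell2 \<Rightarrow> ell2" is "\<lambda>x y k. x k + y k"
  by (rule summable_square_add)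

lift_definition uminus_ell2 :: "ell2 \<Rightarrow> ell2" is "\<lambda>x k. - x k" by simp

lift_definition minus_ell2 :: "ell2 \<Rightarrow> ell2 \<Rightarrow> ell2" is "\<lambda>x y k. x k - y k"
  subgoal for x y using summable_square_add[of x "\<lambda>k. - y k"] by simp
  done

lift_definition scaleR_ell2 :: "real \<Rightarrow> ell2 \<Rightarrow> ell2" is "\<lambda>c x k. c * x k"
  by (simp add: power_mult_distrib summable_mult)

lift_definition inner_ell2 :: "ell2 \<Rightarrow> ell2 \<Rightarrow> real" is "\<lambda>x y. \<Sum>k. x k * y k" .

definition norm_ell2 :: "ell2 \<Rightarrow> real" where "norm_ell2 x = sqrt (x \<bullet> x)"
definition dist_ell2 :: "ell2 \<Rightarrow> ell2 \<Rightarrow> real" where "dist_ell2 x y = norm (x - y)"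
definition sgn_ell2 :: "ell2 \<Rightarrow> ell2" where "sgn_ell2 x = inverse (norm x) *\<^sub>R x"
definition uniformity_ell2 :: "(ell2 \<times> ell2) filter" where
  "uniformity_ell2 = (INF e\<in>{0<..}. principal {(x, y). dist x y < e})"
definition open_ell2 :: "ell2 set \<Rightarrow> bool" where
  "open_ell2 U = (\<forall>x\<in>U. eventually (\<lambda>(x', y). x' = x \<longrightarrow> y \<in> U) uniformity)"

instance
proof
  fix x y z :: ell2 and a b :: real
  show "x + y + z = x + (y + z)" by transfer (simp add: add.assoc)
  show "x + y = y + x" by transfer (simp add: add.commute)
  show "0 + x = x" by transfer simp
  show "- x + x = 0" by transfer simp
  show "x - y = x + - y" by transfer simp
  show "a *\<^sub>R (x + y) = a *\<^sub>R x + a *\<^sub>R y" by transfer (simp add: algebra_simps)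
  show "(a + b) *\<^sub>R x = a *\<^sub>R x + b *\<^sub>R x" by transfer (simp add: algebra_simps)
  show "a *\<^sub>R b *\<^sub>R x = (a * b) *\<^sub>R x" by transfer (simp add: algebra_simps)
  show "1 *\<^sub>R x = x" by transfer simp
  show "x \<bullet> y = y \<bullet> x" by transfer (simp add: mult.commute)
  show "(x + y) \<bullet> z = x \<bullet> z + y \<bullet> z"
    by transfer (simp add: distrib_right suminf_add summable_mult_square_summable)
  show "(a *\<^sub>R x) \<bullet> y = a * (x \<bullet> y)"
    by transfer (simp add: mult.assoc suminf_mult summable_mult_square_summable)
  show "0 \<le> x \<bullet> x"
    by transfer (auto intro!: suminf_nonneg simp: power2_eq_square)
  show "(x \<bullet> x = 0) = (x = 0)"
    by transfer (auto simp: suminf_eq_zero_iff power2_eq_square fun_eq_iff)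
qed (simp_all add: norm_ell2_def dist_ell2_def sgn_ell2_def uniformity_ell2_def open_ell2_def)

end

lemma norm_ell2_eq: "norm x = sqrt (\<Sum>k. (ell2_nth x k)\<^sup>2)"
  by (simp add: norm_ell2_def inner_ell2.rep_eq power2_eq_square)

end

theory Submission
  imports Defs
begin

text \<open>
  For \<open>x = (z, t)\<close> and \<open>y = (w, s)\<close> let \<open>\<psi> x y\<close> be the complex number \<open>\<bar>z - w\<bar>\<^sup>2 - \<i> u\<close>, where \<open>u\<close> is the
  last coordinate of \<open>y\<^sup>-\<^sup>1 x\<close>; its modulus is the squared Koranyi distance. The kernels \<open>exp (- s \<psi>)\<close>
  are positive definite (they are the vacuum states of the Schroedinger representations), hence
  \<open>Re (\<psi> powr (1 - \<epsilon>))\<close> is of negative type and equals \<open>M\<^sup>2\<close> for a Hilbertian metric \<open>M\<close>. Since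
  \<open>Arg \<psi>\<close> has modulus at most \<open>\<pi> / 2\<close>, the ratio \<open>M\<^sup>2 / \<bar>\<psi>\<bar> powr (1 - \<epsilon>) = cos ((1 - \<epsilon>) Arg \<psi>)\<close> is
  between \<open>sin (\<pi> \<epsilon> / 2) \<ge> \<epsilon>\<close> and \<open>1\<close>. The metric \<open>M\<close> is left invariant and homogeneous under
  dilations, so its doubling constant depends only on the homogeneity degree and the dimension
  and not on its distortion.
\<close>

section \<open>Kernels of negative type\<close>

definition pos_def :: "('a \<Rightarrow> 'a \<Rightarrow> complex) \<Rightarrow> bool" where
  "pos_def P \<longleftrightarrow>
    (\<forall>(m::nat) x c. 0 \<le> Re (\<Sum>i<m. \<Sum>j<m. c i * cnj (c j) * P (x i) (x j)))"

lemma pos_defD: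
  fixes m :: nat
  shows "pos_def P \<Longrightarrow> 0 \<le> Re (\<Sum>i<m. \<Sum>j<m. c i * cnj (c j) * P (x i) (x j))"
  unfolding pos_def_def by blast

lemma pos_def_one: "pos_def (\<lambda>x y. 1)"
proof (unfold pos_def_def, intro allI)
  fix m :: nat and c :: "nat \<Rightarrow> complex"
  have "(\<Sum>i<m. \<Sum>j<m. c i * cnj (c j) * 1) = of_real ((cmod (\<Sum>i<m. c i))\<^sup>2)"
    unfolding complex_norm_square by (simp add: sum_product)
  then show "0 \<le> Re (\<Sum>i<m. \<Sum>j<m. c i * cnj (c j) * 1)" by simp
qed

text \<open>The factor \<open>h\<close> is absorbed into the coefficients, which become
  \<open>c i * h (x i)\<close>. A Gram kernel is a finite sum of rank one kernels, so this is the
  product rule behind its powers.\<close>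

lemma pos_def_mult_rank_one:
  assumes "pos_def P"
  shows "pos_def (\<lambda>x y. h x * cnj (h y) * P x y)"
proof (unfold pos_def_def, intro allI)
  fix m :: nat and x and c :: "nat \<Rightarrow> complex"
  show "0 \<le> Re (\<Sum>i<m. \<Sum>j<m. c i * cnj (c j) * (h (x i) * cnj (h (x j)) * P (x i) (x j)))"
    using pos_defD[OF assms, where m = m and c = "\<lambda>i. c i * h (x i)" and x = x] by (simp add: mult_ac)
qed

lemma pos_def_sum:
  assumes "\<And>l. l \<in> L \<Longrightarrow> pos_def (P l)"
  shows "pos_def (\<lambda>x y. \<Sum>l\<in>L. P l x y)"
proof (unfold pos_def_def, intro allI)
  fix m :: nat and x and c :: "nat \<Rightarrow> complex"
  have "(\<Sum>i<m. \<Sum>j<m. c i * cnj (c j) * (\<Sum>l\<in>L. P l (x i) (x j))) =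
      (\<Sum>l\<in>L. \<Sum>i<m. \<Sum>j<m. c i * cnj (c j) * P l (x i) (x j))"
    by (simp add: sum_distrib_left sum.swap[of _ L])
  then show "0 \<le> Re (\<Sum>i<m. \<Sum>j<m. c i * cnj (c j) * (\<Sum>l\<in>L. P l (x i) (x j)))"
    using pos_defD[OF assms] by (simp only: Re_sum[of _ L]) (intro sum_nonneg)
qed

lemma pos_def_scale:
  assumes "pos_def P" "0 \<le> (s::real)"
  shows "pos_def (\<lambda>x y. of_real s * P x y)"
  using pos_def_mult_rank_one[OF assms(1), of "\<lambda>_. of_real (sqrt s)"] assms(2)
  by (simp flip: of_real_mult)

lemma pos_def_LIMSEQ:
  assumes "\<And>k::nat. pos_def (P k)" "\<And>x y. (\<lambda>k. P k x y) \<longlonglongrightarrow> Q x y"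
  shows "pos_def Q"
proof (unfold pos_def_def, intro allI)
  fix m :: nat and x and c :: "nat \<Rightarrow> complex"
  have "(\<lambda>k. Re (\<Sum>i<m. \<Sum>j<m. c i * cnj (c j) * P k (x i) (x j)))
      \<longlonglongrightarrow> Re (\<Sum>i<m. \<Sum>j<m. c i * cnj (c j) * Q (x i) (x j))"
    by (intro tendsto_intros assms)
  then show "0 \<le> Re (\<Sum>i<m. \<Sum>j<m. c i * cnj (c j) * Q (x i) (x j))"
    by (rule LIMSEQ_le_const) (use pos_defD[OF assms(1)] in blast)
qed

lemma pos_def_gram_power: "pos_def (\<lambda>x y. (\<Sum>l\<in>L. z x l * cnj (z y l)) ^ k)"
proof (induction k)
  case 0
  show ?case by (simp add: pos_def_one)
next
  case (Suc k)
  show ?case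
    using pos_def_sum[of L "\<lambda>l x y. z x l * cnj (z y l) * (\<Sum>l\<in>L. z x l * cnj (z y l)) ^ k",
        OF pos_def_mult_rank_one[OF Suc]]
    by (simp add: sum_distrib_right)
qed

text \<open>The exponential series has the nonnegative coefficients \<open>s ^ k / fact k\<close>,
  so its partial sums are nonnegative combinations of powers of a Gram kernel, and the property
  passes to the limit.\<close>

lemma pos_def_exp_gram:
  assumes "0 \<le> (s::real)"
  shows "pos_def (\<lambda>x y. exp (of_real s * (\<Sum>l\<in>L. z x l * cnj (z y l))))"
proof (rule pos_def_LIMSEQ)
  fix N
  have "pos_def (\<lambda>x y. \<Sum>k<N. of_real (s ^ k / fact k) * (\<Sum>l\<in>L. z x l * cnj (z y l)) ^ k)"
    by (intro pos_def_sum pos_def_scale pos_def_gram_power) (use assms in auto)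
  then show "pos_def (\<lambda>x y. \<Sum>k<N. (of_real s * (\<Sum>l\<in>L. z x l * cnj (z y l))) ^ k /\<^sub>R fact k)"
    by (simp add: scaleR_conv_of_real power_mult_distrib field_simps)
next
  fix x y
  show "(\<lambda>N. \<Sum>k<N. (of_real s * (\<Sum>l\<in>L. z x l * cnj (z y l))) ^ k /\<^sub>R fact k)
      \<longlonglongrightarrow> exp (of_real s * (\<Sum>l\<in>L. z x l * cnj (z y l)))"
    using exp_converges sums_def by blast
qed

text \<open>The terms \<open>a x\<close> and \<open>cnj (a y)\<close> split off as a rank one
  factor; what remains is the exponential of a Gram kernel with parameter \<open>2 * s\<close>.
  \<open>siegel_gram\<close> puts the Siegel kernel into this shape.\<close>

lemma pos_def_exp_neg:
  assumes "0 \<le> (s::real)"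
  shows "pos_def (\<lambda>x y. exp (- (of_real s * (a x + cnj (a y) - 2 * (\<Sum>l\<in>L. z x l * cnj (z y l))))))"
proof -
  have "exp (- (of_real s * (a x + cnj (a y) - 2 * (\<Sum>l\<in>L. z x l * cnj (z y l))))) =
     exp (- (of_real s * a x)) * cnj (exp (- (of_real s * a y))) *
     exp (of_real (2 * s) * (\<Sum>l\<in>L. z x l * cnj (z y l)))" for x y
    by (simp add: exp_cnj flip: exp_add) (simp add: algebra_simps)
  then show ?thesis
    using pos_def_mult_rank_one[OF pos_def_exp_gram[where s = "2 * s" and L = L and z = z],
        where h = "\<lambda>x. exp (- (of_real s * a x))"] assms
    by simp
qed

section \<open>Fractional powers of kernels\<close>

text \<open>The first signed coefficient is \<open>- \<beta>\<close>, and each later one arises from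
  its predecessor by a positive factor \<open>(k - \<beta>) / (k + 1)\<close> with
  \<open>1 \<le> k\<close>.\<close>

lemma gbinomial_alternating_nonpos:
  assumes "0 < \<beta>" "\<beta> < (1::real)"
  shows "(\<beta> gchoose Suc k) * (- 1) ^ Suc k \<le> 0"
proof (induction k)
  case 0
  show ?case using assms by simp
next
  case (Suc k)
  have "(\<beta> gchoose Suc (Suc k)) = (\<beta> gchoose Suc k) * ((\<beta> - real (Suc k)) / real (Suc (Suc k)))"
    using gbinomial_mult_1[of \<beta> "Suc k"] by (simp add: field_simps)
  then have "(\<beta> gchoose Suc (Suc k)) * (- 1) ^ Suc (Suc k) =
      ((\<beta> gchoose Suc k) * (- 1) ^ Suc k) * ((real (Suc k) - \<beta>) / real (Suc (Suc k)))"
    by (simp only: power_Suc minus_divide_left[symmetric] minus_diff_eq[symmetric, of "real (Suc k)"])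
      simp
  also have "\<dots> \<le> 0"
    by (rule mult_nonpos_nonneg[OF Suc]) (use assms in simp)
  finally show ?case .
qed

text \<open>The binomial series of \<open>1 - (1 - p)\<^sup>\<beta>\<close> has nonnegative coefficients.\<close>

lemma one_minus_powr_neg_type:
  fixes p :: "'a \<Rightarrow> 'a \<Rightarrow> complex" and c :: "nat \<Rightarrow> real"
  assumes \<beta>: "0 < \<beta>" "\<beta> < (1::real)"
    and pd: "\<And>k. pos_def (\<lambda>x y. p x y ^ k)"
    and lt: "\<And>x y. cmod (p x y) < 1"
    and c: "(\<Sum>i<m. c i) = 0"
  shows "(\<Sum>i<m. \<Sum>j<m. c i * c j * Re ((1 - p (x i) (x j)) powr of_real \<beta>)) \<le> 0"
proof -
  define b where "b k = (\<beta> gchoose k) * (- 1) ^ k" for k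
  define S where "S k = (\<Sum>i<m. \<Sum>j<m. c i * c j * Re (p (x i) (x j) ^ k))" for k
  have sums: "(\<lambda>k. of_real (b k) * p u v ^ k) sums (1 - p u v) powr of_real \<beta>" for u v
  proof -
    have "(complex_of_real \<beta> gchoose k) = of_real (\<beta> gchoose k)" for k
      by (simp add: gbinomial_prod_rev)
    then show ?thesis
      using gen_binomial_complex[of "- p u v" "of_real \<beta>"] lt[of u v]
      by (simp add: b_def power_minus[of "p u v"] mult.assoc)
  qed
  have "(\<lambda>k. Re (of_real (b k) * p u v ^ k)) sums Re ((1 - p u v) powr of_real \<beta>)" for u v
    by (rule sums_Re[OF sums])
  then have "(\<lambda>k. \<Sum>i<m. \<Sum>j<m. c i * c j * (b k * Re (p (x i) (x j) ^ k))) sums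
      (\<Sum>i<m. \<Sum>j<m. c i * c j * Re ((1 - p (x i) (x j)) powr of_real \<beta>))"
    by (intro sums_sum sums_mult) simp
  moreover have "(\<Sum>i<m. \<Sum>j<m. c i * c j * (b k * Re (p (x i) (x j) ^ k))) = b k * S k" for k
    by (simp add: S_def sum_distrib_left mult_ac)
  moreover have "b k * S k \<le> 0" for k
  proof (cases k)
    \<comment> \<open>Only the constant term has a positive coefficient; it contributes the square
      of the sum of the \<open>c i\<close>, which vanishes.\<close>
    case 0
    have "S 0 = (\<Sum>i<m. c i) * (\<Sum>i<m. c i)"
      by (simp add: S_def sum_product)
    with c show ?thesis using 0 by simp
  next
    case (Suc k')
    have "0 \<le> S k"
      using pos_defD[OF pd[of k], where m = m and c = "\<lambda>i. of_real (c i)" and x = x]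
      by (simp add: S_def flip: of_real_mult)
    moreover have "b k \<le> 0"
      unfolding b_def Suc by (rule gbinomial_alternating_nonpos[OF \<beta>])
    ultimately show ?thesis by (rule mult_nonpos_nonneg[rotated])
  qed
  ultimately show ?thesis
    by (metis (mono_tags, lifting) sums_le sums_zero)
qed

text \<open>As \<open>l\<close> tends to 0, \<open>\<psi>\<close> is the limit of
  \<open>(1 - p) / l\<close> for \<open>p = exp (- l * (\<psi> + l))\<close>. Powers of
  \<open>p\<close> are positive multiples of kernels covered by \<open>pd\<close>, so the binomial
  argument applies to every \<open>1 - p\<close>.\<close>

lemma powr_neg_type:
  fixes \<psi> :: "'a \<Rightarrow> 'a \<Rightarrow> complex" and c :: "nat \<Rightarrow> real"
  assumes \<beta>: "0 < \<beta>" "\<beta> < (1::real)"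
    and pd: "\<And>s. 0 \<le> (s::real) \<Longrightarrow> pos_def (\<lambda>x y. exp (- (of_real s * \<psi> x y)))"
    and Re: "\<And>x y. 0 \<le> Re (\<psi> x y)"
    and c: "(\<Sum>i<m. c i) = 0"
  shows "(\<Sum>i<m. \<Sum>j<m. c i * c j * Re (\<psi> (x i) (x j) powr of_real \<beta>)) \<le> 0"
proof -
  define l where "l k = inverse (real (Suc k))" for k
  have l: "0 < l k" for k by (simp add: l_def)
  have l0: "l \<longlonglongrightarrow> 0" unfolding l_def by (rule LIMSEQ_inverse_real_of_nat)
  \<comment> \<open>The additional \<open>l k\<close> gives \<open>cmod p < 1\<close> even where
    \<open>Re \<psi>\<close> vanishes, as the binomial series requires.\<close>
  define p where "p k u v = exp (- (of_real (l k) * (\<psi> u v + of_real (l k))))" for k u v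
  have le: "(\<Sum>i<m. \<Sum>j<m. c i * c j * Re (((1 - p k (x i) (x j)) / of_real (l k)) powr of_real \<beta>)) \<le> 0"
    for k
  proof -
    have "(\<Sum>i<m. \<Sum>j<m. c i * c j * Re ((1 - p k (x i) (x j)) powr of_real \<beta>)) \<le> 0"
    proof (rule one_minus_powr_neg_type[OF \<beta> _ _ c])
      fix r
      have "p k u v ^ r = of_real (exp (- (real r * (l k)\<^sup>2))) * exp (- (of_real (real r * l k) * \<psi> u v))"
        for u v
        unfolding p_def exp_of_nat_mult[symmetric] exp_of_real[symmetric] exp_add[symmetric]
        by (simp add: algebra_simps power2_eq_square)
      then show "pos_def (\<lambda>u v. p k u v ^ r)"
        using pos_def_scale[OF pd[of "real r * l k"], of "exp (- (real r * (l k)\<^sup>2))"] l[of k]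
        by simp
    next
      fix u v
      have "0 < l k * (Re (\<psi> u v) + l k)"
        using l[of k] Re[of u v] by (intro mult_pos_pos add_nonneg_pos) auto
      then show "cmod (p k u v) < 1" by (simp add: p_def)
    qed
    \<comment> \<open>Dividing by a positive real shifts \<open>Ln\<close> by a real number, so the
      power only acquires a positive real factor and the sign of the sum survives.\<close>
    moreover have "((1 - p k u v) / of_real (l k)) powr of_real \<beta> =
        of_real (exp (- (\<beta> * ln (l k)))) * (1 - p k u v) powr of_real \<beta>" for u v
    proof (cases "1 - p k u v = 0")
      case False
      then have "Ln ((1 - p k u v) / of_real (l k)) = Ln (1 - p k u v) - of_real (ln (l k))"
        using Ln_divide_of_real[OF l[of k]] Ln_of_real[OF l[of k]] by simp
      moreover have "exp (of_real \<beta> * (Ln (1 - p k u v) - of_real (ln (l k)))) =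
          exp (of_real (- (\<beta> * ln (l k)))) * exp (of_real \<beta> * Ln (1 - p k u v))"
        by (simp only: exp_add[symmetric]) (simp add: algebra_simps)
      moreover have "(1 - p k u v) / of_real (l k) \<noteq> 0"
        using False l[of k] by simp
      ultimately show ?thesis
        using False by (simp only: powr_def if_False exp_of_real[symmetric])
    qed simp
    then have "(\<Sum>i<m. \<Sum>j<m. c i * c j * Re (((1 - p k (x i) (x j)) / of_real (l k)) powr of_real \<beta>)) =
       exp (- (\<beta> * ln (l k))) * (\<Sum>i<m. \<Sum>j<m. c i * c j * Re ((1 - p k (x i) (x j)) powr of_real \<beta>))"
      by (simp add: sum_distrib_left mult_ac)
    ultimately show ?thesis by (simp add: mult_nonneg_nonpos)
  qed
  have lim: "(\<lambda>k. (1 - p k u v) / of_real (l k)) \<longlonglongrightarrow> \<psi> u v" for u v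
  proof -
    define w where "w k = of_real (l k) * (\<psi> u v + of_real (l k))" for k
    \<comment> \<open>The shift also keeps \<open>w k\<close> off 0, so that the derivative of
      \<open>exp\<close> at 0 can be used through the punctured filter \<open>at 0\<close>.\<close>
    have ne: "\<psi> u v + of_real (l k) \<noteq> 0" for k
      using l[of k] Re[of u v] by (auto simp: complex_eq_iff)
    have lc: "(\<lambda>k. complex_of_real (l k)) \<longlonglongrightarrow> 0"
      using tendsto_of_real[OF l0] by simp
    have "w \<longlonglongrightarrow> 0 * (\<psi> u v + 0)"
      unfolding w_def by (intro tendsto_intros lc)
    then have w: "filterlim (\<lambda>k. - w k) (at 0) sequentially"
    proof -
      have "- w k \<noteq> 0" for k
        using ne[of k] l[of k] by (simp add: w_def less_imp_neq[THEN not_sym])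
      moreover have "(\<lambda>k. - w k) \<longlonglongrightarrow> 0"
        using tendsto_minus[OF \<open>w \<longlonglongrightarrow> 0 * (\<psi> u v + 0)\<close>] by simp
      ultimately show ?thesis by (simp add: filterlim_at)
    qed
    have "((\<lambda>h::complex. (exp h - 1) / h) \<longlongrightarrow> 1) (at 0)"
      using DERIV_exp[of "0::complex"] by (simp add: DERIV_def)
    from filterlim_compose[OF this w]
    have "(\<lambda>k. (exp (- w k) - 1) / (- w k)) \<longlonglongrightarrow> 1" .
    then have "(\<lambda>k. (exp (- w k) - 1) / (- w k) * (\<psi> u v + of_real (l k))) \<longlonglongrightarrow> 1 * (\<psi> u v + 0)"
      by (intro tendsto_intros lc)
    moreover have "(exp (- w k) - 1) / (- w k) * (\<psi> u v + of_real (l k)) = (1 - p k u v) / of_real (l k)"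
      for k
    proof -
      have "(a - 1) / (- (b * c)) * c = (1 - a) / b" if "b \<noteq> 0" "c \<noteq> 0" for a b c :: complex
        using that by (simp add: field_simps)
      from this[of "of_real (l k)" _ "exp (- w k)", OF _ ne[of k]] show ?thesis
        using l[of k] by (simp add: w_def p_def)
    qed
    ultimately show ?thesis by simp
  qed
  \<comment> \<open>The closed right half plane meets the branch cut only at 0, where the power is
    continuous because \<open>0 < \<beta>\<close>.\<close>
  have "(\<lambda>k. ((1 - p k u v) / of_real (l k)) powr of_real \<beta>) \<longlonglongrightarrow> \<psi> u v powr of_real \<beta>" for u v
    using Re[of u v] \<beta>(1)
    by (intro tendsto_powr_complex' lim tendsto_const)
      (auto simp: complex_nonpos_Reals_iff complex_eq_iff)
  then have "(\<lambda>k. \<Sum>i<m. \<Sum>j<m. c i * c j * Re (((1 - p k (x i) (x j)) / of_real (l k)) powr of_real \<beta>))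
      \<longlonglongrightarrow> (\<Sum>i<m. \<Sum>j<m. c i * c j * Re (\<psi> (x i) (x j) powr of_real \<beta>))"
    by (intro tendsto_sum tendsto_mult tendsto_const tendsto_Re)
  then show ?thesis
    by (rule LIMSEQ_le_const2) (use le in blast)
qed

section \<open>Embedding of kernels into the Hilbert space\<close>

definition psd_kernel :: "('a \<Rightarrow> 'a \<Rightarrow> real) \<Rightarrow> bool" where
  "psd_kernel G \<longleftrightarrow> (\<forall>x y. G x y = G y x) \<and>
    (\<forall>(m::nat) x c. 0 \<le> (\<Sum>i<m. \<Sum>j<m. c i * c j * G (x i) (x j)))"

lemma psd_kernel_sym: "psd_kernel G \<Longrightarrow> G x y = G y x"
  by (simp add: psd_kernel_def)

lemma psd_kernelD:
  fixes m :: nat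
  shows "psd_kernel G \<Longrightarrow> 0 \<le> (\<Sum>i<m. \<Sum>j<m. c i * c j * G (x i) (x j))"
  by (simp add: psd_kernel_def)

lemma psd_kernel_two:
  assumes "psd_kernel G"
  shows "0 \<le> a\<^sup>2 * G x x + 2 * a * b * G x y + b\<^sup>2 * G y y"
  using psd_kernelD[OF assms, where m = 2 and c = "\<lambda>i. if i = 0 then a else b"
      and x = "\<lambda>i. if i = 0 then x else y"] psd_kernel_sym[OF assms, of y x]
  by (simp add: numeral_2_eq_2 power2_eq_square algebra_simps)

lemma psd_kernel_diag: "psd_kernel G \<Longrightarrow> 0 \<le> G x x"
  using psd_kernel_two[of G 1 x 0 x] by simp

text \<open>With a zero at \<open>p\<close> on the diagonal, the form with weights \<open>a\<close>
  at \<open>p\<close> and 1 at \<open>y\<close> is affine in \<open>a\<close>; it stays nonnegative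
  only if its slope vanishes.\<close>

lemma psd_kernel_null:
  assumes "psd_kernel G" "G p p = 0"
  shows "G p y = 0"
proof (rule ccontr)
  assume ne: "G p y \<noteq> 0"
  \<comment> \<open>The weight is chosen so that the form equals -1.\<close>
  have "0 \<le> 2 * (- (G y y + 1) / (2 * G p y)) * 1 * G p y + G y y"
    using psd_kernel_two[OF assms(1), of "- (G y y + 1) / (2 * G p y)" p 1 y] assms(2) by simp
  then show False using ne by (simp add: field_simps)
qed

text \<open>Appends the point \<open>p\<close> with weight \<open>t\<close> to a configuration. A
  suitable \<open>t\<close> drives both the Schur complement and Schoenberg's argument.\<close>

lemma sum_bordered:
  fixes c :: "nat \<Rightarrow> real"
  shows "(\<Sum>i<Suc m. \<Sum>j<Suc m. (c(m := t)) i * (c(m := t)) j * G ((x(m := p)) i) ((x(m := p)) j)) =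
    (\<Sum>i<m. \<Sum>j<m. c i * c j * G (x i) (x j)) + t * (\<Sum>i<m. c i * G (x i) p)
      + t * (\<Sum>j<m. c j * G p (x j)) + t\<^sup>2 * G p p"
  by (simp add: sum.distrib sum_distrib_left power2_eq_square mult_ac)

text \<open>For \<open>G p p = 0\<close>, division by zero leaves \<open>G\<close> unchanged. For a
  positive semidefinite \<open>G\<close> the row of \<open>p\<close> is then already zero by
  \<open>psd_kernel_null\<close>.\<close>

definition schur_compl :: "'a \<Rightarrow> ('a \<Rightarrow> 'a \<Rightarrow> real) \<Rightarrow> 'a \<Rightarrow> 'a \<Rightarrow> real" where
  "schur_compl p G x y = G x y - G x p * G p y / G p p"

text \<open>The form of the Schur complement is the form of \<open>G\<close> after \<open>p\<close>
  has been added with its optimal weight.\<close>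

lemma psd_schur_compl:
  assumes G: "psd_kernel G"
  shows "psd_kernel (schur_compl p G)"
  unfolding psd_kernel_def
proof (intro conjI allI)
  show "schur_compl p G x y = schur_compl p G y x" for x y
    using psd_kernel_sym[OF G] by (simp add: schur_compl_def mult.commute)
next
  fix m :: nat and x and c :: "nat \<Rightarrow> real"
  define s where "s = (\<Sum>i<m. c i * G (x i) p)"
  have s': "(\<Sum>j<m. c j * G p (x j)) = s"
    using psd_kernel_sym[OF G] by (simp add: s_def)
  \<comment> \<open>Minimizer of \<open>Q + 2 * t * s + t\<^sup>2 * G p p\<close>; it is 0 when
    \<open>G p p = 0\<close>.\<close>
  define t where "t = - s / G p p"
  define Q where "Q = (\<Sum>i<m. \<Sum>j<m. c i * c j * G (x i) (x j))"
  have "0 \<le> (\<Sum>i<Suc m. \<Sum>j<Suc m.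
      (c(m := t)) i * (c(m := t)) j * G ((x(m := p)) i) ((x(m := p)) j))"
    by (rule psd_kernelD[OF G])
  also have "\<dots> = Q + t * s + t * s + t\<^sup>2 * G p p"
    unfolding sum_bordered s' by (simp add: s_def Q_def)
  also have "\<dots> = Q - s * s / G p p"
    unfolding t_def by (cases "G p p = 0") (simp_all add: field_simps power2_eq_square)
  also have "s * s / G p p = (\<Sum>i<m. \<Sum>j<m. c i * c j * (G (x i) p * G p (x j) / G p p))"
  proof -
    have "s * s = (\<Sum>i<m. \<Sum>j<m. (c i * G (x i) p) * (c j * G p (x j)))"
      unfolding sum_product[symmetric] s' by (simp add: s_def)
    then show ?thesis by (simp add: sum_divide_distrib mult_ac)
  qed
  finally show "0 \<le> (\<Sum>i<m. \<Sum>j<m. c i * c j * schur_compl p G (x i) (x j))"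
    by (simp add: Q_def schur_compl_def sum_subtractf right_diff_distrib)
qed

text \<open>Cholesky factorization of a kernel along a sequence \<open>p\<close>.\<close>

primrec residual :: "(nat \<Rightarrow> 'a) \<Rightarrow> ('a \<Rightarrow> 'a \<Rightarrow> real) \<Rightarrow> nat \<Rightarrow> 'a \<Rightarrow> 'a \<Rightarrow> real" where
  "residual p G 0 = G"
| "residual p G (Suc k) = schur_compl (p k) (residual p G k)"

text \<open>These are Gram-Schmidt coordinates for the sequence \<open>p\<close> in the Hilbert
  space with Gram kernel \<open>G\<close>. A zero pivot yields the coordinate 0.\<close>

definition chol :: "(nat \<Rightarrow> 'a) \<Rightarrow> ('a \<Rightarrow> 'a \<Rightarrow> real) \<Rightarrow> 'a \<Rightarrow> nat \<Rightarrow> real" where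
  "chol p G x k = residual p G k x (p k) / sqrt (residual p G k (p k) (p k))"

lemma psd_residual: "psd_kernel G \<Longrightarrow> psd_kernel (residual p G k)"
  by (induction k) (auto intro: psd_schur_compl)

text \<open>Telescoping: the product of the coordinates with index \<open>k\<close> is exactly what
  step \<open>k\<close> subtracts from the residual.\<close>

lemma chol_sum:
  assumes "psd_kernel G"
  shows "(\<Sum>k<N. chol p G x k * chol p G y k) = G x y - residual p G N x y"
proof (induction N)
  case (Suc N)
  have R: "psd_kernel (residual p G N)" by (rule psd_residual[OF assms])
  have "chol p G x N * chol p G y N =
      residual p G N x (p N) * residual p G N (p N) y / residual p G N (p N) (p N)"
    using psd_kernel_diag[OF R, of "p N"] psd_kernel_sym[OF R, of y "p N"]
    by (simp add: chol_def)
  with Suc show ?case by (simp add: schur_compl_def)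
qed simp

text \<open>Step \<open>j\<close> clears the row of \<open>p j\<close>, unless the pivot is zero and
  the row vanishes already; later Schur complements keep a zero row.\<close>

lemma residual_null:
  assumes "psd_kernel G" "j < k"
  shows "residual p G k (p j) y = 0"
  using assms(2)
proof (induction k arbitrary: y)
  case (Suc k)
  show ?case
  proof (cases "j = k")
    case True
    then show ?thesis
      using psd_kernel_null[OF psd_residual[OF assms(1), of p k], of "p k" y]
      by (cases "residual p G k (p k) (p k) = 0") (auto simp: schur_compl_def)
  next
    case False
    with Suc show ?thesis by (simp add: schur_compl_def)
  qed
qed simp

text \<open>Squared distance in the Hilbert space with Gram kernel \<open>G\<close>.\<close>

definition kdist :: "('a \<Rightarrow> 'a \<Rightarrow> real) \<Rightarrow> 'a \<Rightarrow> 'a \<Rightarrow> real" where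
  "kdist G x y = G x x - 2 * G x y + G y y"

lemma kdist_nonneg: "psd_kernel G \<Longrightarrow> 0 \<le> kdist G x y"
  using psd_kernel_two[of G 1 x "- 1" y] by (simp add: kdist_def)

lemma kdist_sum:
  assumes "psd_kernel G"
  shows "(\<Sum>k<N. (chol p G x k - chol p G y k)\<^sup>2) = kdist G x y - kdist (residual p G N) x y"
proof -
  have "(\<Sum>k<N. (chol p G x k - chol p G y k)\<^sup>2) =
    (\<Sum>k<N. chol p G x k * chol p G x k) - 2 * (\<Sum>k<N. chol p G x k * chol p G y k)
     + (\<Sum>k<N. chol p G y k * chol p G y k)"
    by (simp add: power2_eq_square sum_distrib_left algebra_simps flip: sum.distrib sum_subtractf)
  then show ?thesis
    unfolding chol_sum[OF assms] by (simp add: kdist_def)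
qed

text \<open>A dense sequence makes the residual vanish in the limit because it is decreasing and
  vanishes at \<open>p j\<close> from step \<open>j + 1\<close> on.\<close>

lemma residual_tendsto_0:
  assumes G: "psd_kernel G"
    and dense: "\<And>e. 0 < e \<Longrightarrow> \<exists>j. kdist G x (p j) < e"
  shows "(\<lambda>k. residual p G k x x) \<longlonglongrightarrow> 0"
proof (rule LIMSEQ_I)
  fix e :: real assume "0 < e"
  then obtain j where j: "kdist G x (p j) < e" using dense by blast
  show "\<exists>N. \<forall>k\<ge>N. norm (residual p G k x x - 0) < e"
  proof (intro exI allI impI)
    fix k assume "Suc j \<le> k"
    then have "residual p G k x x = kdist (residual p G k) x (p j)"
      using residual_null[OF G, of j k] psd_kernel_sym[OF psd_residual[OF G], of p k x "p j"]
      by (simp add: kdist_def)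
    also have "\<dots> \<le> kdist G x (p j)"
      using kdist_sum[OF G, of p x "p j" k] sum_nonneg[of "{..<k}" "\<lambda>i. (chol p G x i - chol p G (p j) i)\<^sup>2"]
      by simp
    finally show "norm (residual p G k x x - 0) < e"
      using j psd_kernel_diag[OF psd_residual[OF G], of p k x] by simp
  qed
qed

text \<open>The Cholesky coordinates form the embedding. Their first \<open>N\<close> entries miss
  the squared distance by the \<open>kdist\<close> of the residual, which tends to 0 by density of
  \<open>p\<close>.\<close>

lemma psd_kernel_embedding:
  fixes G :: "'a \<Rightarrow> 'a \<Rightarrow> real" and p :: "nat \<Rightarrow> 'a"
  assumes G: "psd_kernel G"
    and dense: "\<And>x e. x \<in> X \<Longrightarrow> 0 < e \<Longrightarrow> \<exists>j. kdist G x (p j) < e"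
  shows "\<exists>f :: 'a \<Rightarrow> ell2. \<forall>x\<in>X. \<forall>y\<in>X. norm (f x - f y) = sqrt (kdist G x y)"
proof (intro exI ballI)
  fix x y assume xy: "x \<in> X" "y \<in> X"
  let ?f = "\<lambda>x. Abs_ell2 (chol p G x)"
  have summable: "summable (\<lambda>k. (chol p G x k)\<^sup>2)" for x
  proof (rule bounded_imp_summable)
    fix n
    have "(\<Sum>k\<le>n. (chol p G x k)\<^sup>2) = G x x - residual p G (Suc n) x x"
      unfolding chol_sum[OF G, symmetric] lessThan_Suc_atMost by (simp add: power2_eq_square)
    then show "(\<Sum>k\<le>n. (chol p G x k)\<^sup>2) \<le> G x x"
      using psd_kernel_diag[OF psd_residual[OF G], of p "Suc n" x] by linarith
  qed simp
  then have nth: "ell2_nth (?f x) = chol p G x" for x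
    by (simp add: Abs_ell2_inverse)
  have lim0: "(\<lambda>k. kdist (residual p G k) x y) \<longlonglongrightarrow> 0"
  proof (rule tendsto_sandwich)
    show "\<forall>\<^sub>F k in sequentially. 0 \<le> kdist (residual p G k) x y"
      using kdist_nonneg[OF psd_residual[OF G]] by simp
    \<comment> \<open>The bound \<open>norm (u - v) ^ 2 \<le> 2 * (norm u ^ 2 + norm v ^ 2)\<close>,
      from nonnegativity of the form with weights 1 and 1.\<close>
    have "kdist (residual p G k) x y \<le> 2 * (residual p G k x x + residual p G k y y)" for k
      using psd_kernel_two[OF psd_residual[OF G], of 1 p k x 1 y] by (simp add: kdist_def)
    then show "\<forall>\<^sub>F k in sequentially.
        kdist (residual p G k) x y \<le> 2 * (residual p G k x x + residual p G k y y)"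
      by simp
    show "(\<lambda>k. 2 * (residual p G k x x + residual p G k y y)) \<longlonglongrightarrow> 0"
      using residual_tendsto_0[OF G dense[OF xy(1)]] residual_tendsto_0[OF G dense[OF xy(2)]]
      by (auto intro!: tendsto_eq_intros)
  qed simp
  have "(\<lambda>N. \<Sum>k<N. (chol p G x k - chol p G y k)\<^sup>2) \<longlonglongrightarrow> kdist G x y - 0"
    unfolding kdist_sum[OF G] by (intro tendsto_intros lim0)
  then have "(\<Sum>k. (chol p G x k - chol p G y k)\<^sup>2) = kdist G x y"
    by (simp add: sums_def sums_unique[symmetric])
  then show "norm (?f x - ?f y) = sqrt (kdist G x y)"
    by (simp add: norm_ell2_eq minus_ell2.rep_eq nth)
qed

text \<open>Schoenberg: distances to a base point turn a kernel of negative type into a positive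
  semidefinite one.\<close>

lemma neg_type_embedding:
  fixes K :: "'a \<Rightarrow> 'a \<Rightarrow> real" and p :: "nat \<Rightarrow> 'a"
  assumes sym: "\<And>x y. K x y = K y x" and diag: "\<And>x. K x x = 0"
    and neg: "\<And>(m::nat) x c. (\<Sum>i<m. c i) = 0 \<Longrightarrow> (\<Sum>i<m. \<Sum>j<m. c i * c j * K (x i) (x j)) \<le> 0"
    and dense: "\<And>x e. x \<in> X \<Longrightarrow> 0 < e \<Longrightarrow> \<exists>j. K x (p j) < e"
  shows "\<exists>f :: 'a \<Rightarrow> ell2. \<forall>x\<in>X. \<forall>y\<in>X. norm (f x - f y) = sqrt (K x y)"
proof -
  fix o' :: 'a
  \<comment> \<open>By polarization this is the inner product of \<open>f x - f o'\<close> and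
    \<open>f y - f o'\<close> for the desired \<open>f\<close>.\<close>
  define G where "G x y = (K x o' + K y o' - K x y) / 2" for x y
  have kd: "kdist G x y = K x y" for x y
    using diag by (simp add: kdist_def G_def field_simps)
  have "psd_kernel G"
    unfolding psd_kernel_def
  proof (intro conjI allI)
    show "G x y = G y x" for x y using sym[of x y] by (simp add: G_def)
    fix m :: nat and x and c :: "nat \<Rightarrow> real"
    define s where "s = (\<Sum>i<m. c i)"
    define q where "q = (\<Sum>i<m. c i * K (x i) o')"
    have q': "(\<Sum>j<m. c j * K o' (x j)) = q" by (simp add: q_def sym)
    define Q where "Q = (\<Sum>i<m. \<Sum>j<m. c i * c j * K (x i) (x j))"
    \<comment> \<open>Giving the base point the weight \<open>- s\<close> makes the total weight
      zero, so that \<open>neg\<close> applies to arbitrary \<open>c\<close>.\<close>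
    have "(\<Sum>i<Suc m. (c(m := - s)) i) = 0" by (simp add: s_def)
    from neg[OF this, of "x(m := o')"] have "Q + (- s) * q + (- s) * q \<le> 0"
      unfolding sum_bordered q' by (simp add: Q_def q_def diag)
    then have "0 \<le> 2 * (q * s) - Q" by (simp add: mult.commute)
    also have "2 * (q * s) - Q = (\<Sum>i<m. \<Sum>j<m. c i * K (x i) o' * c j)
        + (\<Sum>i<m. \<Sum>j<m. c i * (c j * K (x j) o')) - Q"
      unfolding sum_product[symmetric] q_def[symmetric] s_def[symmetric] by simp
    also have "\<dots> = 2 * (\<Sum>i<m. \<Sum>j<m. c i * c j * G (x i) (x j))"
      by (simp add: Q_def G_def sum_distrib_left flip: sum.distrib sum_subtractf)
        (intro sum.cong refl, simp add: field_simps)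
    finally show "0 \<le> (\<Sum>i<m. \<Sum>j<m. c i * c j * G (x i) (x j))" by simp
  qed
  from psd_kernel_embedding[OF this, of X p] dense show ?thesis by (simp add: kd)
qed

section \<open>Doubling of self-similar metrics\<close>

lemma le_of_power_le:
  fixes a A B :: real
  assumes "0 < B" "\<And>k. a ^ k \<le> A * B ^ k"
  shows "a \<le> B"
proof (rule ccontr)
  assume "\<not> a \<le> B"
  then have "1 < a / B" using assms(1) by simp
  then obtain k where "A < (a / B) ^ k" using real_arch_pow by blast
  then have "A * B ^ k < a ^ k"
    using assms(1) by (simp add: power_divide field_simps)
  with assms(2)[of k] show False by simp
qed

text \<open>Substituting scaled copies of the packing \<open>S\<close> into itself \<open>k\<close> times gives
  \<open>card S ^ k\<close> points, so a counting bound that is crude by a factor \<open>A\<close> independent of \<open>k\<close>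
  loses nothing.\<close>

lemma self_similar_packing:
  fixes M :: "'a \<Rightarrow> 'a \<Rightarrow> real" and mul :: "'a \<Rightarrow> 'a \<Rightarrow> 'a"
  assumes sym: "\<And>x y. M x y = M y x"
    and tri: "\<And>x y z. x \<in> X \<Longrightarrow> y \<in> X \<Longrightarrow> z \<in> X \<Longrightarrow> M x z \<le> M x y + M y z"
    and e: "e \<in> X" and mul: "\<And>x y. x \<in> X \<Longrightarrow> y \<in> X \<Longrightarrow> mul x y \<in> X"
    and dil: "\<And>x. x \<in> X \<Longrightarrow> dil x \<in> X"
    and mul_e: "\<And>x. x \<in> X \<Longrightarrow> mul x e = x" and dil_e: "dil e = e"
    and M_mul: "\<And>g x y. g \<in> X \<Longrightarrow> x \<in> X \<Longrightarrow> y \<in> X \<Longrightarrow> M (mul g x) (mul g y) = M x y"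
    and M_dil: "\<And>x y. x \<in> X \<Longrightarrow> y \<in> X \<Longrightarrow> M (dil x) (dil y) = M x y / 8"
    and count: "\<And>k T. finite T \<Longrightarrow> T \<subseteq> X \<Longrightarrow> (\<And>x. x \<in> T \<Longrightarrow> M e x \<le> 2) \<Longrightarrow>
      (\<And>x y. x \<in> T \<Longrightarrow> y \<in> T \<Longrightarrow> x \<noteq> y \<Longrightarrow> 1 / 8 ^ k \<le> M x y) \<Longrightarrow> real (card T) \<le> A * B ^ k"
    and B: "0 < B"
    and S: "finite S" "S \<subseteq> X" "\<And>x. x \<in> S \<Longrightarrow> M e x \<le> 1"
      "\<And>x y. x \<in> S \<Longrightarrow> y \<in> S \<Longrightarrow> x \<noteq> y \<Longrightarrow> 1 / 2 < M x y"
  shows "real (card S) \<le> B"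
proof -
  have "M e e = 0" using M_dil[OF e e] dil_e by simp
  then have refl: "M x x = 0" if "x \<in> X" for x
    using M_mul[OF that e e] mul_e[OF that] by simp
  have M_md: "M (mul s (dil y)) (mul s (dil y')) = M y y' / 8" if "s \<in> X" "y \<in> X" "y' \<in> X" for s y y'
    using that by (simp add: M_mul M_dil dil)
  have M_md_e: "M s (mul s (dil y)) = M e y / 8" if "s \<in> X" "y \<in> X" for s y
    using M_md[OF that(1) e that(2)] that(1) by (simp add: dil_e mul_e)
  define m where "m = (\<lambda>(s, y). mul s (dil y))"
  define T where "T = rec_nat {e} (\<lambda>_ T. m ` (S \<times> T))"
  \<comment> \<open>The radius \<open>8 / 7\<close> is the limit of
    \<open>1 + 1/8 + 1/64 + ...\<close> and reproduces itself:
    \<open>1 + (8 / 7) / 8 = 8 / 7\<close>.\<close>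
  have T: "finite (T k) \<and> T k \<subseteq> X \<and> (\<forall>x\<in>T k. M e x \<le> 8 / 7) \<and>
      (\<forall>x\<in>T k. \<forall>y\<in>T k. x \<noteq> y \<longrightarrow> 1 / 8 ^ k \<le> M x y) \<and> card (T k) = card S ^ k" for k
  proof (induction k)
    case 0
    show ?case using \<open>M e e = 0\<close> e by (simp add: T_def)
  next
    case (Suc k)
    have TS: "T (Suc k) = m ` (S \<times> T k)" by (simp add: T_def)
    have X: "s \<in> X" "y \<in> X" if "s \<in> S" "y \<in> T k" for s y
      using that S(2) Suc by auto
    have sep: "1 / 8 ^ Suc k \<le> M (m (s, y)) (m (s', y'))"
      if *: "s \<in> S" "y \<in> T k" "s' \<in> S" "y' \<in> T k" and ne: "(s, y) \<noteq> (s', y')" for s y s' y'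
    proof (cases "s = s'")
      case True
      with ne have "1 / 8 ^ k \<le> M y y'" using Suc * by auto
      moreover have "M (m (s, y)) (m (s', y')) = M y y' / 8"
        using M_md[OF X[OF *(1,2)] X(2)[OF *(3,4)]] True by (simp add: m_def)
      ultimately show ?thesis by simp
    next
      case False
      have mX: "m (s, y) \<in> X" "m (s', y') \<in> X" using * X by (auto simp: m_def mul dil)
      \<comment> \<open>Copies around different centres stay apart by
        \<open>1/2 - 2 * (1/7) = 3/14\<close>, which exceeds \<open>1/8\<close>.\<close>
      have "1 / 2 < M s s'" using S(4) * False by blast
      also have "M s s' \<le> M s (m (s, y)) + (M (m (s, y)) (m (s', y')) + M (m (s', y')) s')"
        using tri[of s "m (s, y)" s'] tri[of "m (s, y)" "m (s', y')" s'] X(1)[OF *(1,2)] X(1)[OF *(3,4)] mX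
        by simp
      also have "M s (m (s, y)) \<le> 1 / 7"
        using M_md_e[OF X[OF *(1,2)]] Suc *(2) by (auto simp: m_def)
      also have "M (m (s', y')) s' \<le> 1 / 7"
        using M_md_e[OF X[OF *(3,4)]] Suc *(4) by (auto simp: m_def sym[of _ s'])
      finally have "1 / 8 \<le> M (m (s, y)) (m (s', y'))" by simp
      moreover have "(1::real) / 8 ^ Suc k \<le> 1 / 8"
        using power_increasing[of 1 "Suc k" "8::real"] by (simp add: field_simps)
      ultimately show ?thesis by linarith
    qed
    have mX: "m ` (S \<times> T k) \<subseteq> X" using X by (auto simp: m_def mul dil)
    \<comment> \<open>Separation forces distinct pairs to distinct points, so the cardinalities
      multiply.\<close>
    have "inj_on m (S \<times> T k)"
    proof (rule inj_onI, rule ccontr)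
      fix a b assume ab: "a \<in> S \<times> T k" "b \<in> S \<times> T k" "m a = m b" "a \<noteq> b"
      then have "1 / 8 ^ Suc k \<le> M (m a) (m b)"
        using sep[of "fst a" "snd a" "fst b" "snd b"] by (auto simp: mem_Times_iff)
      moreover have "m a \<in> X" using ab(1) mX by blast
      then have "M (m a) (m b) = 0" using ab(3) refl[of "m a"] by simp
      moreover have "(0::real) < 1 / 8 ^ Suc k" by simp
      ultimately show False by linarith
    qed
    then have "card (T (Suc k)) = card S ^ Suc k"
      using Suc by (simp add: TS card_image card_cartesian_product)
    moreover have "M e (m (s, y)) \<le> 8 / 7" if *: "s \<in> S" "y \<in> T k" for s y
    proof -
      have "m (s, y) \<in> X" using mX * by blast
      then have "M e (m (s, y)) \<le> M e s + M s (m (s, y))"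
        using tri[OF e, of s "m (s, y)"] X * by simp
      also have "M s (m (s, y)) \<le> 1 / 7"
        using M_md_e[OF X[OF *]] Suc *(2) by (auto simp: m_def)
      finally show ?thesis using S(3)[of s] * by simp
    qed
    moreover have "1 / 8 ^ Suc k \<le> M a b" if "a \<in> m ` (S \<times> T k)" "b \<in> m ` (S \<times> T k)" "a \<noteq> b" for a b
    proof -
      obtain s y s' y' where "a = m (s, y)" "b = m (s', y')" "s \<in> S" "y \<in> T k" "s' \<in> S" "y' \<in> T k"
        using \<open>a \<in> m ` (S \<times> T k)\<close> \<open>b \<in> m ` (S \<times> T k)\<close> by auto
      then show ?thesis using sep[of s y s' y'] \<open>a \<noteq> b\<close> by blast
    qed
    moreover have "finite (m ` (S \<times> T k))" using Suc S(1) by simp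
    ultimately show ?case
      using mX unfolding TS by (intro conjI ballI impI) blast+
  qed
  have "real (card S) ^ k \<le> A * B ^ k" for k
  proof -
    have "M e x \<le> 2" if "x \<in> T k" for x
    proof -
      have "M e x \<le> 8 / 7" using T[of k] that by blast
      then show ?thesis by simp
    qed
    then have "real (card (T k)) \<le> A * B ^ k"
      using T[of k] by (intro count) blast+
    then show ?thesis using T[of k] by simp
  qed
  then show ?thesis using le_of_power_le[OF B] by blast
qed

section \<open>From packings to coverings\<close>

text \<open>The packing bound yields an \<open>r / 2\<close>-separated subset of the ball of largest
  cardinality. A point farther than \<open>r / 2\<close> from all of it could be added, so the
  closed balls of radius \<open>r / 2\<close> around it cover.\<close>

lemma (in Metric_space) doubling_if_packing_bound:
  assumes "\<And>x r S. x \<in> M \<Longrightarrow> 0 < r \<Longrightarrow> finite S \<Longrightarrow> S \<subseteq> mcball x r \<Longrightarrow>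
      (\<And>y z. y \<in> S \<Longrightarrow> z \<in> S \<Longrightarrow> y \<noteq> z \<Longrightarrow> r / 2 < d y z) \<Longrightarrow> real (card S) \<le> K"
  shows "doubling_constant_at_most K"
  unfolding doubling_constant_at_most_def
proof (intro ballI allI impI)
  fix x and r :: real assume x: "x \<in> M" and r: "0 < r"
  let ?P = "\<lambda>S. finite S \<and> S \<subseteq> mcball x r \<and> (\<forall>y\<in>S. \<forall>z\<in>S. y \<noteq> z \<longrightarrow> r / 2 < d y z)"
  have bound: "real (card S) \<le> K" if "?P S" for S
    using that by (intro assms[OF x r]) blast+
  have "card S \<le> nat \<lfloor>K\<rfloor>" if "?P S" for S
    using bound[OF that] by (rule le_nat_floor)
  then have bounded: "\<forall>S. ?P S \<longrightarrow> card S < Suc (nat \<lfloor>K\<rfloor>)" by (simp add: less_Suc_eq_le)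
  have empty: "?P {}" by simp
  obtain S where S: "?P S" and max: "\<And>S'. ?P S' \<Longrightarrow> card S' \<le> card S"
    using ex_has_greatest_nat[where P = ?P and f = card, OF empty bounded] by iprover
  have cover: "\<exists>z\<in>S. d z y \<le> r / 2" if y: "y \<in> mcball x r" for y
  proof (rule ccontr)
    assume far: "\<not> (\<exists>z\<in>S. d z y \<le> r / 2)"
    have "d y y \<le> r / 2" using y r by simp
    then have "y \<notin> S" using far by blast
    moreover have "?P (insert y S)"
    proof (intro conjI ballI impI)
      fix u v assume "u \<in> insert y S" "v \<in> insert y S" "u \<noteq> v"
      then consider "u \<in> S" "v \<in> S" | "u = y" "v \<in> S" | "u \<in> S" "v = y" by blast
      then show "r / 2 < d u v"
      proof cases
        case 1
        then show ?thesis using S \<open>u \<noteq> v\<close> by blast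
      next
        case 2
        then show ?thesis using far by (metis commute not_le)
      next
        case 3
        then show ?thesis using far by (simp add: not_le)
      qed
    qed (simp add: S, use S y in blast)
    ultimately show False using max[of "insert y S"] S by simp
  qed
  have "S \<subseteq> M" using S by auto
  have "mcball x r \<subseteq> (\<Union>y\<in>S. mcball y (r / 2))"
  proof (intro subsetI)
    fix y assume y: "y \<in> mcball x r"
    then obtain z where "z \<in> S" "d z y \<le> r / 2"
      using cover by blast
    then show "y \<in> (\<Union>y\<in>S. mcball y (r / 2))"
      using y \<open>S \<subseteq> M\<close> by (intro UN_I[of z]) auto
  qed
  with \<open>S \<subseteq> M\<close> show "\<exists>F\<subseteq>M. finite F \<and> real (card F) \<le> K \<and> mcball x r \<subseteq> (\<Union>y\<in>F. mcball y (r / 2))"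
    using conjunct1[OF S] bound[OF S] by (intro exI[of _ S] conjI)
qed

section \<open>The Siegel kernel of the Heisenberg group\<close>

text \<open>The mean value theorem gives \<open>sin x = x * cos z\<close> with
  \<open>z \<le> pi / 4\<close>; the crude bounds \<open>3 \<le> pi\<close> and
  \<open>2 / 3 \<le> cos z\<close> then multiply to exactly 2.\<close>

lemma sin_ge_two_over_pi:
  assumes "0 \<le> \<epsilon>" "\<epsilon> \<le> 1 / 2"
  shows "\<epsilon> \<le> sin (\<epsilon> * pi / 2)"
proof (cases "\<epsilon> = 0")
  case False
  have mvt: "\<exists>z. 0 < z \<and> z < x \<and> sin x = x * cos z" if "0 < x" for x :: real
    using MVT2[OF that, of sin cos] by auto
  obtain z where "sin (pi / 6) = pi / 6 * cos z"
    using mvt[of "pi / 6"] by auto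
  \<comment> \<open>\<open>1 / 2 = sin (pi / 6) \<le> pi / 6\<close>.\<close>
  then have pi3: "3 \<le> pi" using cos_le_one[of z] mult_left_mono[of "cos z" 1 "pi / 6"]
    by (simp add: sin_30)
  obtain z where z: "0 < z" "z < \<epsilon> * pi / 2" "sin (\<epsilon> * pi / 2) = \<epsilon> * pi / 2 * cos z"
    using mvt[of "\<epsilon> * pi / 2"] False assms(1) by auto
  have "z \<le> pi / 4" using mult_right_mono[OF assms(2) pi_ge_zero] z(2) by linarith
  then have "cos (pi / 4) \<le> cos z" using z(1) by (intro cos_monotone_0_pi_le) auto
  moreover have "(4 / 3 :: real) \<le> sqrt 2" by (rule real_le_rsqrt) (simp add: power2_eq_square)
  ultimately have "2 / 3 \<le> cos z" by (simp add: cos_45)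
  then have "3 * (2 / 3) \<le> pi * cos z" using pi3 by (intro mult_mono) auto
  then have "\<epsilon> * 2 \<le> \<epsilon> * (pi * cos z)" using assms(1) by (intro mult_left_mono) auto
  then show ?thesis using z(3) by simp
qed simp

text \<open>The argument of \<open>w\<close> is at most \<open>pi / 2\<close> in modulus; the factor
  \<open>1 - \<epsilon>\<close> keeps it away from the zeros of the cosine by at least
  \<open>\<epsilon> * pi / 2\<close>.\<close>

lemma Re_powr_bounds:
  assumes \<epsilon>: "0 < \<epsilon>" "\<epsilon> < 1 / 2" and w: "0 \<le> Re w"
  shows "\<epsilon> * cmod w powr (1 - \<epsilon>) \<le> Re (w powr of_real (1 - \<epsilon>))"
    and "Re (w powr of_real (1 - \<epsilon>)) \<le> cmod w powr (1 - \<epsilon>)"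
proof -
  show "Re (w powr of_real (1 - \<epsilon>)) \<le> cmod w powr (1 - \<epsilon>)"
    using complex_Re_le_cmod[of "w powr of_real (1 - \<epsilon>)"] norm_powr_real_powr'[of "of_real (1 - \<epsilon>)" w]
    by simp
  show "\<epsilon> * cmod w powr (1 - \<epsilon>) \<le> Re (w powr of_real (1 - \<epsilon>))"
  proof (cases "w = 0")
    case False
    have Arg: "\<bar>Im (Ln w)\<bar> \<le> pi / 2"
      using w False Arg_Re_nonneg[of w] by (simp add: Arg_def)
    have "Re (w powr of_real (1 - \<epsilon>)) = exp ((1 - \<epsilon>) * Re (Ln w)) * cos ((1 - \<epsilon>) * Im (Ln w))"
      using False by (simp add: powr_def Re_exp del: of_real_diff)
    also have "exp ((1 - \<epsilon>) * Re (Ln w)) = cmod w powr (1 - \<epsilon>)"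
      using False by (simp add: powr_def)
    also have "cos ((1 - \<epsilon>) * Im (Ln w)) = cos ((1 - \<epsilon>) * \<bar>Im (Ln w)\<bar>)"
      by (simp add: abs_if)
    finally have Re: "Re (w powr of_real (1 - \<epsilon>)) =
        cmod w powr (1 - \<epsilon>) * cos ((1 - \<epsilon>) * \<bar>Im (Ln w)\<bar>)" .
    have "\<epsilon> \<le> cos ((1 - \<epsilon>) * \<bar>Im (Ln w)\<bar>)"
    proof -
      have "\<epsilon> \<le> sin (\<epsilon> * pi / 2)" using \<epsilon> by (intro sin_ge_two_over_pi) auto
      also have "\<dots> = cos ((1 - \<epsilon>) * (pi / 2))"
        by (subst sin_cos_eq, rule arg_cong[of _ _ cos]) (simp add: field_simps)
      also have "\<dots> \<le> cos ((1 - \<epsilon>) * \<bar>Im (Ln w)\<bar>)"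
      proof (rule cos_monotone_0_pi_le)
        show "(1 - \<epsilon>) * \<bar>Im (Ln w)\<bar> \<le> (1 - \<epsilon>) * (pi / 2)"
          using Arg \<epsilon> by (intro mult_left_mono) auto
        show "(1 - \<epsilon>) * (pi / 2) \<le> pi"
          using \<epsilon> by (simp add: algebra_simps)
      qed (use \<epsilon> in auto)
      finally show ?thesis .
    qed
    from mult_left_mono[OF this, of "cmod w powr (1 - \<epsilon>)"] show ?thesis
      unfolding Re by (simp add: mult.commute)
  qed simp
qed

text \<open>With \<open>x = (z, t)\<close> and \<open>y = (w, s)\<close>, this is \<open>\<bar>z - w\<bar>\<^sup>2 - \<i> u\<close> where \<open>u\<close> is the last coordinate
  of \<open>y\<^sup>-\<^sup>1 x\<close>.\<close>

definition siegel :: "nat \<Rightarrow> (nat \<Rightarrow> complex) \<times> real \<Rightarrow> (nat \<Rightarrow> complex) \<times> real \<Rightarrow> complex" where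
  "siegel n x y = Complex (\<Sum>j=1..n. (cmod (fst x j - fst y j))\<^sup>2)
    (snd y - snd x + 2 * (\<Sum>j=1..n. Im (fst y j * cnj (fst x j))))"

section \<open>Symmetries of the Siegel kernel and the Koranyi distance\<close>

lemma siegel_Re_nonneg: "0 \<le> Re (siegel n x y)"
  by (simp add: siegel_def sum_nonneg)

lemma siegel_cnj: "siegel n y x = cnj (siegel n x y)"
proof -
  have "(\<Sum>j=1..n. Im (fst x j * cnj (fst y j))) = - (\<Sum>j=1..n. Im (fst y j * cnj (fst x j)))"
    by (simp add: sum_negf[symmetric] algebra_simps)
  then show ?thesis
    by (simp add: siegel_def complex_eq_iff norm_minus_commute)
qed

lemma siegel_self: "siegel n x x = 0"
  by (simp add: siegel_def complex_eq_iff mult.commute)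

text \<open>The mixed term of the squared distance and the symplectic term of the group law are the
  real and imaginary parts of one Hermitian product. This is what makes
  \<open>pos_def_exp_neg\<close> applicable.\<close>

lemma siegel_gram:
  "siegel n x y = Complex (\<Sum>j=1..n. (cmod (fst x j))\<^sup>2) (- snd x)
    + cnj (Complex (\<Sum>j=1..n. (cmod (fst y j))\<^sup>2) (- snd y))
    - 2 * (\<Sum>j\<in>{1..n}. fst x j * cnj (fst y j))"
proof -
  have "(\<Sum>j=1..n. (cmod (fst x j - fst y j))\<^sup>2) = (\<Sum>j=1..n. (cmod (fst x j))\<^sup>2)
      + (\<Sum>j=1..n. (cmod (fst y j))\<^sup>2) - 2 * (\<Sum>j\<in>{1..n}. Re (fst x j * cnj (fst y j)))"
    unfolding sum_distrib_left sum.distrib[symmetric] sum_subtractf[symmetric]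
    unfolding cmod_power2 by (intro sum.cong refl) (simp add: power2_eq_square algebra_simps)
  moreover have "(\<Sum>j=1..n. Im (fst y j * cnj (fst x j))) = - (\<Sum>j=1..n. Im (fst x j * cnj (fst y j)))"
    by (simp add: sum_negf[symmetric] algebra_simps)
  ultimately show ?thesis
    by (simp add: siegel_def complex_eq_iff)
qed

lemma heisenberg_mult:
  "x \<otimes>\<^bsub>heisenberg n\<^esub> y = ((\<lambda>j. fst x j + fst y j),
    snd x + snd y + 2 * (\<Sum>j=1..n. Im (fst x j * cnj (fst y j))))"
  by (simp add: heisenberg_def split_beta)

lemma koranyi_dist_eq:
  assumes "x \<in> carrier (heisenberg n)" "y \<in> carrier (heisenberg n)"
  shows "koranyi_dist n x y = sqrt (cmod (siegel n x y))"
proof -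
  have inv: "inv\<^bsub>heisenberg n\<^esub> y = ((\<lambda>j. - fst y j), - snd y)"
    using inv_heisenberg[of "fst y" "snd y" n] assms(2) by simp
  define r where "r = (\<Sum>j=1..n. (cmod (fst x j - fst y j))\<^sup>2)"
  define i where "i = snd y - snd x + 2 * (\<Sum>j=1..n. Im (fst y j * cnj (fst x j)))"
  have "L2_set (\<lambda>j. cmod (- fst y j + fst x j)) {1..n} ^ 4 = r\<^sup>2"
  proof -
    have "sqrt r ^ 4 = ((sqrt r)\<^sup>2)\<^sup>2" by (simp flip: power_mult)
    then show ?thesis by (simp add: L2_set_def r_def sum_nonneg)
  qed
  moreover have "(- snd y + snd x + 2 * (\<Sum>j=1..n. Im (- fst y j * cnj (fst x j))))\<^sup>2 = i\<^sup>2"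
  proof -
    have neg: "(\<Sum>j=1..n. Im (- fst y j * cnj (fst x j))) = - (\<Sum>j=1..n. Im (fst y j * cnj (fst x j)))"
      unfolding sum_negf[symmetric] by simp
    show ?thesis
      unfolding i_def neg by (simp add: power2_eq_square algebra_simps del: times_complex.simps)
  qed
  ultimately have "koranyi_dist n x y = root 4 (r\<^sup>2 + i\<^sup>2)"
    by (simp add: koranyi_dist_def koranyi_norm_def inv heisenberg_mult)
  also have "\<dots> = sqrt (sqrt (r\<^sup>2 + i\<^sup>2))"
    using real_root_mult_exp[of 2 2 "r\<^sup>2 + i\<^sup>2"] by (simp add: sqrt_def)
  also have "sqrt (r\<^sup>2 + i\<^sup>2) = cmod (siegel n x y)"
    by (simp add: siegel_def r_def i_def cmod_def)
  finally show ?thesis .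
qed

text \<open>The mixed terms with \<open>g\<close> from the symplectic form cancel those that the
  product adds to the last coordinates.\<close>

lemma siegel_mult:
  "siegel n (g \<otimes>\<^bsub>heisenberg n\<^esub> x) (g \<otimes>\<^bsub>heisenberg n\<^esub> y) = siegel n x y"
proof -
  have "(\<Sum>j=1..n. Im ((fst g j + fst y j) * cnj (fst g j + fst x j))) =
      (\<Sum>j=1..n. Im (fst y j * cnj (fst x j))) + (\<Sum>j=1..n. Im (fst g j * cnj (fst x j)))
       - (\<Sum>j=1..n. Im (fst g j * cnj (fst y j)))"
    unfolding sum.distrib[symmetric] sum_subtractf[symmetric]
    by (intro sum.cong refl) (simp add: algebra_simps)
  then show ?thesis
    by (simp add: siegel_def heisenberg_mult del: times_complex.simps)
qed

text \<open>The parabolic dilations of the Heisenberg group: the centre has weight two.\<close>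

definition dilation :: "real \<Rightarrow> (nat \<Rightarrow> complex) \<times> real \<Rightarrow> (nat \<Rightarrow> complex) \<times> real" where
  "dilation q x = ((\<lambda>j. of_real q * fst x j), q\<^sup>2 * snd x)"

lemma dilation_carrier: "x \<in> carrier (heisenberg n) \<Longrightarrow> dilation q x \<in> carrier (heisenberg n)"
  by (auto simp: dilation_def heisenberg_def)

lemma siegel_dilation: "siegel n (dilation q x) (dilation q y) = of_real (q\<^sup>2) * siegel n x y"
proof -
  have "(cmod (of_real q * a - of_real q * b))\<^sup>2 = q\<^sup>2 * (cmod (a - b))\<^sup>2" for a b
    by (simp flip: right_diff_distrib add: norm_mult power_mult_distrib)
  then have "(\<Sum>j=1..n. (cmod (of_real q * fst x j - of_real q * fst y j))\<^sup>2) =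
      q\<^sup>2 * (\<Sum>j=1..n. (cmod (fst x j - fst y j))\<^sup>2)"
    by (simp add: sum_distrib_left)
  moreover have "Im (of_real q * a * cnj (of_real q * b)) = q\<^sup>2 * Im (a * cnj b)" for a b
    by (simp add: power2_eq_square algebra_simps)
  then have "(\<Sum>j=1..n. Im (of_real q * fst y j * cnj (of_real q * fst x j))) =
      q\<^sup>2 * (\<Sum>j=1..n. Im (fst y j * cnj (fst x j)))"
    unfolding sum_distrib_left by (intro sum.cong refl)
  moreover have "of_real (q\<^sup>2) * Complex a b = Complex (q\<^sup>2 * a) (q\<^sup>2 * b)" for a b
    by (simp add: complex_eq_iff del: of_real_power)
  ultimately show ?thesis
    by (simp only: siegel_def dilation_def fst_conv snd_conv) (simp add: algebra_simps)
qed

lemma continuous_siegel: "continuous_on UNIV (siegel n x)"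
proof -
  have "continuous_on UNIV (\<lambda>y :: (nat \<Rightarrow> complex) \<times> real. fst y j)" for j
    by (rule continuous_on_compose2[OF continuous_on_product_coordinates])
      (auto intro: continuous_intros)
  then show ?thesis
    unfolding siegel_def Complex_eq by (intro continuous_intros)
qed

section \<open>The snowflake embedding\<close>

text \<open>Each \<open>j\<close> contributes at most \<open>4 * R * \<delta>\<close> to the real
  part and twice \<open>2 * R * \<delta>\<close> to the imaginary part; the last coordinate adds
  less than \<open>\<delta> \<le> R * \<delta>\<close>.\<close>

lemma siegel_close:
  assumes R: "1 \<le> R" and \<delta>: "0 < \<delta>" "\<delta> \<le> 1"
    and bound: "\<And>j. j \<in> {1..n} \<Longrightarrow> cmod (fst x j) \<le> R"
    and Re: "\<And>j. j \<in> {1..n} \<Longrightarrow> \<bar>Re (fst x j) - Re (fst y j)\<bar> < \<delta>"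
    and Im: "\<And>j. j \<in> {1..n} \<Longrightarrow> \<bar>Im (fst x j) - Im (fst y j)\<bar> < \<delta>"
    and t: "\<bar>snd x - snd y\<bar> < \<delta>"
  shows "cmod (siegel n x y) < (8 * real n + 1) * R * \<delta>"
proof -
  have diff: "cmod (fst x j - fst y j) \<le> 2 * \<delta>" if "j \<in> {1..n}" for j
    using cmod_le[of "fst x j - fst y j"] Re[OF that] Im[OF that] by simp
  have "(cmod (fst x j - fst y j))\<^sup>2 \<le> 4 * R * \<delta>" if "j \<in> {1..n}" for j
  proof -
    have "(cmod (fst x j - fst y j))\<^sup>2 \<le> (2 * \<delta>)\<^sup>2"
      using diff[OF that] by (intro power_mono) auto
    also have "\<dots> \<le> 4 * (1 * \<delta>)"
      using \<delta> mult_right_mono[of \<delta> 1 \<delta>] by (simp add: power2_eq_square)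
    also have "\<dots> \<le> 4 * (R * \<delta>)"
      using R \<delta> by (intro mult_left_mono mult_right_mono) auto
    finally show ?thesis by simp
  qed
  then have "(\<Sum>j=1..n. (cmod (fst x j - fst y j))\<^sup>2) \<le> real n * (4 * R * \<delta>)"
    using sum_bounded_above[of "{1..n}" "\<lambda>j. (cmod (fst x j - fst y j))\<^sup>2"] by simp
  moreover have "0 \<le> (\<Sum>j=1..n. (cmod (fst x j - fst y j))\<^sup>2)"
    by (simp add: sum_nonneg)
  moreover have "\<bar>\<Sum>j=1..n. Im (fst y j * cnj (fst x j))\<bar> \<le> real n * (2 * R * \<delta>)"
  proof -
    have "\<bar>Im (fst y j * cnj (fst x j))\<bar> \<le> 2 * R * \<delta>" if "j \<in> {1..n}" for j
    proof -
      \<comment> \<open>Subtracting a real number exposes the small difference of \<open>x\<close>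
        and \<open>y\<close>.\<close>
      have "Im (fst y j * cnj (fst x j)) = Im ((fst y j - fst x j) * cnj (fst x j))"
        by (simp add: algebra_simps)
      also have "\<bar>\<dots>\<bar> \<le> cmod (fst x j - fst y j) * cmod (fst x j)"
        using abs_Im_le_cmod[of "(fst y j - fst x j) * cnj (fst x j)"]
        by (simp add: norm_mult norm_minus_commute del: times_complex.simps)
      also have "\<dots> \<le> 2 * \<delta> * R"
        using diff[OF that] bound[OF that] \<delta> by (intro mult_mono) auto
      finally show ?thesis by (simp add: mult_ac)
    qed
    then have "(\<Sum>j=1..n. \<bar>Im (fst y j * cnj (fst x j))\<bar>) \<le> real n * (2 * R * \<delta>)"
      using sum_bounded_above[of "{1..n}" "\<lambda>j. \<bar>Im (fst y j * cnj (fst x j))\<bar>"] by simp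
    then show ?thesis
      using sum_abs[of "\<lambda>j. Im (fst y j * cnj (fst x j))" "{1..n}"] by linarith
  qed
  moreover have "cmod (siegel n x y) \<le> \<bar>Re (siegel n x y)\<bar> + \<bar>Im (siegel n x y)\<bar>"
    by (rule cmod_le)
  moreover have "\<delta> \<le> R * \<delta>" using mult_right_mono[OF R] \<delta>(1) by fastforce
  moreover have "(8 * real n + 1) * R * \<delta> = real n * (4 * R * \<delta>) + 2 * (real n * (2 * R * \<delta>)) + R * \<delta>"
    by (simp add: algebra_simps)
  ultimately show ?thesis
    using t unfolding siegel_def complex.sel by linarith
qed

text \<open>Pigeonhole on a grid in the \<open>2 * n + 1\<close> real coordinates: two points in one
  cell would be too close. Only the exponent of \<open>1 / \<eta>\<close> matters later.\<close>

lemma siegel_separated_card_le: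
  assumes R: "1 \<le> R" and \<eta>: "0 < \<eta>" "\<eta> \<le> 1"
    and bound: "\<And>x j. x \<in> T \<Longrightarrow> j \<in> {1..n} \<Longrightarrow> cmod (fst x j) \<le> R"
    and bound_t: "\<And>x. x \<in> T \<Longrightarrow> \<bar>snd x\<bar> \<le> R"
    and sep: "\<And>x y. x \<in> T \<Longrightarrow> y \<in> T \<Longrightarrow> x \<noteq> y \<Longrightarrow> \<eta> \<le> cmod (siegel n x y)"
  shows "real (card T) \<le> (4 * (8 * real n + 1) * R\<^sup>2 / \<eta>) ^ (2 * n + 1)"
proof -
  define \<delta> where "\<delta> = \<eta> / ((8 * real n + 1) * R)"
  have nR: "1 \<le> (8 * real n + 1) * R"
    using mult_mono[of 1 "8 * real n + 1" 1 R] R by simp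
  have \<delta>: "0 < \<delta>" "\<delta> \<le> 1" "(8 * real n + 1) * R * \<delta> = \<eta>"
    using nR \<eta> by (auto simp: \<delta>_def intro!: divide_pos_pos)
  define I where "I = {\<lfloor>- R / \<delta>\<rfloor>..\<lfloor>R / \<delta>\<rfloor>}"
  have I: "\<lfloor>a / \<delta>\<rfloor> \<in> I" if "\<bar>a\<bar> \<le> R" for a
    using that \<delta>(1) unfolding I_def atLeastAtMost_iff
    by (intro conjI floor_mono divide_right_mono) auto
  have "1 \<le> R / \<delta>" using R \<delta> by simp
  \<comment> \<open>There are at most \<open>2 * R / \<delta> + 2\<close> integers in
    \<open>I\<close>, and \<open>1 \<le> R / \<delta>\<close> absorbs the 2.\<close>
  then have "real (card I) \<le> 4 * R / \<delta>"
    unfolding I_def card_atLeastAtMost_int by (simp add: le_nat_iff) linarith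
  also have "4 * R / \<delta> = 4 * (8 * real n + 1) * R\<^sup>2 / \<eta>"
    by (simp add: \<delta>_def power2_eq_square)
  finally have card_I: "real (card I) \<le> 4 * (8 * real n + 1) * R\<^sup>2 / \<eta>" .
  define \<phi> where "\<phi> x = ((\<lambda>j\<in>{1..n}. (\<lfloor>Re (fst x j) / \<delta>\<rfloor>, \<lfloor>Im (fst x j) / \<delta>\<rfloor>)), \<lfloor>snd x / \<delta>\<rfloor>)"
    for x :: "(nat \<Rightarrow> complex) \<times> real"
  have close: "\<bar>a - b\<bar> < \<delta>" if "\<lfloor>a / \<delta>\<rfloor> = \<lfloor>b / \<delta>\<rfloor>" for a b
  proof -
    have "\<bar>a / \<delta> - b / \<delta>\<bar> < 1" using that by linarith
    then show ?thesis using \<delta>(1) by (simp flip: diff_divide_distrib)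
  qed
  have "inj_on \<phi> T"
  proof (rule inj_onI, rule ccontr)
    fix x y assume xy: "x \<in> T" "y \<in> T" "\<phi> x = \<phi> y" "x \<noteq> y"
    have "cmod (siegel n x y) < (8 * real n + 1) * R * \<delta>"
    proof (rule siegel_close[OF R \<delta>(1,2) bound[OF xy(1)]])
      fix j assume j: "j \<in> {1..n}"
      have "fst (\<phi> x) j = fst (\<phi> y) j" using xy(3) by simp
      then show "\<bar>Re (fst x j) - Re (fst y j)\<bar> < \<delta>" "\<bar>Im (fst x j) - Im (fst y j)\<bar> < \<delta>"
        using j by (auto simp: \<phi>_def intro: close)
    next
      show "\<bar>snd x - snd y\<bar> < \<delta>" using xy(3) by (auto simp: \<phi>_def intro: close)
    qed
    then show False using sep[OF xy(1,2,4)] \<delta>(3) by simp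
  qed
  moreover have "\<phi> ` T \<subseteq> (\<Pi>\<^sub>E j\<in>{1..n}. I \<times> I) \<times> I"
  proof
    fix u assume "u \<in> \<phi> ` T"
    then obtain x where x: "x \<in> T" "u = \<phi> x" by blast
    have "\<bar>Re (fst x j)\<bar> \<le> R" "\<bar>Im (fst x j)\<bar> \<le> R" if "j \<in> {1..n}" for j
      using bound[OF x(1) that] abs_Re_le_cmod[of "fst x j"] abs_Im_le_cmod[of "fst x j"] by auto
    then show "u \<in> (\<Pi>\<^sub>E j\<in>{1..n}. I \<times> I) \<times> I"
      using bound_t[OF x(1)] by (auto simp: x(2) \<phi>_def intro!: I)
  qed
  moreover have "finite ((\<Pi>\<^sub>E j\<in>{1..n}. I \<times> I) \<times> I)"
    by (intro finite_cartesian_product finite_PiE) (auto simp: I_def)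
  ultimately have "card T \<le> card ((\<Pi>\<^sub>E j\<in>{1..n}. I \<times> I) \<times> I)"
    by (rule card_inj_on_le)
  also have "\<dots> = card I ^ (2 * n + 1)"
    by (simp add: card_PiE card_cartesian_product power_mult power2_eq_square)
  finally have "real (card T) \<le> real (card I) ^ (2 * n + 1)"
    by (simp only: of_nat_le_iff flip: of_nat_power)
  also have "\<dots> \<le> (4 * (8 * real n + 1) * R\<^sup>2 / \<eta>) ^ (2 * n + 1)"
    by (intro power_mono card_I) simp
  finally show ?thesis .
qed

section \<open>Existence and doubling of the embedding\<close>

lemma siegel_powr_embedding:
  assumes \<beta>: "0 < \<beta>" "\<beta> < (1::real)"
  shows "\<exists>f :: (nat \<Rightarrow> complex) \<times> real \<Rightarrow> ell2.
    \<forall>x y. norm (f x - f y) = sqrt (Re (siegel n x y powr of_real \<beta>))"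
proof -
  define K where "K x y = Re (siegel n x y powr of_real \<beta>)" for x y
  \<comment> \<open>The product topology on the whole type is second countable and
    \<open>K x\<close> is continuous for it, so \<open>D\<close> supplies the dense
    sequence.\<close>
  obtain D :: "((nat \<Rightarrow> complex) \<times> real) set"
    where D: "countable D" "\<And>U. open U \<Longrightarrow> U \<noteq> {} \<Longrightarrow> \<exists>d\<in>D. d \<in> U"
    using countable_dense_setE by blast
  have "D \<noteq> {}" using D(2)[of UNIV] by auto
  have "\<exists>f :: (nat \<Rightarrow> complex) \<times> real \<Rightarrow> ell2. \<forall>x\<in>UNIV. \<forall>y\<in>UNIV. norm (f x - f y) = sqrt (K x y)"
  proof (rule neg_type_embedding)
    show "K x y = K y x" for x y
    proof -
      have "siegel n y x powr of_real \<beta> = cnj (siegel n x y powr of_real \<beta>)"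
        using cnj_powr[of "siegel n x y" "of_real \<beta>"] siegel_Re_nonneg[of n x y]
        by (simp add: siegel_cnj[of n y x])
      then show ?thesis by (simp add: K_def)
    qed
    show "K x x = 0" for x by (simp add: K_def siegel_self)
    show "(\<Sum>i<m. \<Sum>j<m. c i * c j * K (x i) (x j)) \<le> 0" if "(\<Sum>i<m. c i) = 0"
      for m :: nat and x c
      unfolding K_def
    proof (rule powr_neg_type[OF \<beta> _ siegel_Re_nonneg that])
      fix s :: real assume "0 \<le> s"
      then show "pos_def (\<lambda>x y. exp (- (of_real s * siegel n x y)))"
        unfolding siegel_gram by (rule pos_def_exp_neg)
    qed
    show "\<exists>j. K x (from_nat_into D j) < e" if "0 < e" for x e
    proof -
      have "continuous_on UNIV (K x)"
        unfolding K_def using \<beta> siegel_Re_nonneg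
        by (intro continuous_on_Re continuous_on_powr_complex continuous_siegel continuous_intros) auto
      then have "open {y. K x y < e}"
        by (intro open_Collect_less continuous_on_const)
      moreover have "x \<in> {y. K x y < e}" using that by (simp add: K_def siegel_self)
      ultimately obtain d where d: "d \<in> D" "K x d < e" using D(2)[of "{y. K x y < e}"] by blast
      obtain j where "from_nat_into D j = d" using from_nat_into_surj[OF D(1) d(1)] by blast
      with d(2) show ?thesis by blast
    qed
  qed
  then show ?thesis by (simp add: K_def)
qed

text \<open>The distortion enters only through \<open>R\<close>, hence through the factor
  \<open>A\<close> that \<open>self_similar_packing\<close> discards. The base comes from
  \<open>4096 = 8 ^ 4\<close>: \<open>M\<close>-separation \<open>8 ^ - k\<close> forces
  \<open>cmod \<psi>\<close> to be at least \<open>4096 ^ - k\<close>.\<close>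

lemma doubling_siegel_powr_embedding:
  fixes f :: "(nat \<Rightarrow> complex) \<times> real \<Rightarrow> ell2"
  assumes \<epsilon>: "0 < \<epsilon>" "\<epsilon> < 1 / 2"
    and f: "\<And>x y. norm (f x - f y) = sqrt (Re (siegel n x y powr of_real (1 - \<epsilon>)))"
  shows "Metric_space.doubling_constant_at_most (f ` carrier (heisenberg n)) dist (4096 ^ (2 * n + 1))"
proof -
  let ?X = "carrier (heisenberg n)"
  interpret H: group "heisenberg n" by (rule group_heisenberg)
  define M where "M x y = norm (f x - f y)" for x y
  define \<beta> where "\<beta> = 1 - \<epsilon>"
  have \<beta>: "1 / 2 < \<beta>" "\<beta> < 1" using \<epsilon> by (auto simp: \<beta>_def)
  have Msq: "(M x y)\<^sup>2 = Re (siegel n x y powr of_real \<beta>)" for x y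
  proof -
    have "0 \<le> \<epsilon> * cmod (siegel n x y) powr (1 - \<epsilon>)" using \<epsilon> by simp
    then show ?thesis
      using Re_powr_bounds(1)[OF \<epsilon> siegel_Re_nonneg, of n x y] by (simp add: M_def f \<beta>_def)
  qed
  have M_eq: "M x y = sqrt (Re (siegel n x y powr of_real \<beta>))" for x y
    by (simp add: M_def f \<beta>_def)
  have lower: "\<epsilon> * cmod (siegel n x y) powr \<beta> \<le> (M x y)\<^sup>2"
    and upper: "(M x y)\<^sup>2 \<le> cmod (siegel n x y) powr \<beta>" for x y
    using Re_powr_bounds[OF \<epsilon> siegel_Re_nonneg, of n x y] by (simp_all add: Msq \<beta>_def)
  have M_sym: "M x y = M y x" for x y by (simp add: M_def norm_minus_commute)
  have M_tri: "M x z \<le> M x y + M y z" for x y z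
    using norm_triangle_ineq[of "f x - f y" "f y - f z"] by (simp add: M_def)
  have M_mult: "M (g \<otimes>\<^bsub>heisenberg n\<^esub> x) (g \<otimes>\<^bsub>heisenberg n\<^esub> y) = M x y" for g x y
    by (simp add: M_eq siegel_mult)
  \<comment> \<open>This dilation multiplies \<open>\<psi>\<close> by
    \<open>s powr (2 / \<beta>)\<close>, its power by \<open>s\<^sup>2\<close>, and \<open>M\<close>
    by \<open>s\<close>.\<close>
  have M_dil: "M (dilation (s powr (1 / \<beta>)) x) (dilation (s powr (1 / \<beta>)) y) = s * M x y"
    if "0 < s" for s x y
  proof -
    have "(of_real r * w) powr of_real \<beta> = of_real (r powr \<beta>) * w powr of_real \<beta>" if "0 < r"
      for r and w :: complex
    proof (cases "w = 0")
      case False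
      then have "exp (of_real \<beta> * Ln (of_real r * w)) = exp (of_real (\<beta> * ln r)) * exp (of_real \<beta> * Ln w)"
        using Ln_times_of_real[OF that False] Ln_of_real[OF that]
        by (simp add: distrib_left flip: exp_add del: exp_of_real)
      then show ?thesis
        using False that by (simp add: powr_def flip: exp_of_real)
    qed simp
    from this[of "(s powr (1 / \<beta>))\<^sup>2" "siegel n x y"] that
    have "siegel n (dilation (s powr (1 / \<beta>)) x) (dilation (s powr (1 / \<beta>)) y) powr of_real \<beta> =
        of_real (((s powr (1 / \<beta>))\<^sup>2) powr \<beta>) * siegel n x y powr of_real \<beta>"
      unfolding siegel_dilation by simp
    moreover have "((s powr (1 / \<beta>))\<^sup>2) powr \<beta> = s\<^sup>2"
      using that \<beta> by (simp add: powr_powr powr_mult power2_eq_square)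
    ultimately show ?thesis
      using that by (simp add: M_eq real_sqrt_mult)
  qed
  \<comment> \<open>Solves \<open>\<epsilon> * R powr \<beta> = 4\<close>, the lower bound at the
    edge of the \<open>M\<close>-ball of radius 2.\<close>
  define R where "R = (4 / \<epsilon>) powr (1 / \<beta>)"
  have R: "1 \<le> R" unfolding R_def using \<epsilon> \<beta> by (intro ge_one_powr_ge_zero) auto
  let ?e = "\<one>\<^bsub>heisenberg n\<^esub>"
  let ?A = "(4 * (8 * real n + 1) * R\<^sup>2) ^ (2 * n + 1)"
  have swap: "(a ^ m) ^ k = (a ^ k) ^ m" for a :: real and m k
    by (simp only: mult.commute flip: power_mult)
  have packing: "real (card S) \<le> 4096 ^ (2 * n + 1)"
    if S: "finite S" "S \<subseteq> ?X" "\<And>x. x \<in> S \<Longrightarrow> M ?e x \<le> 1"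
      "\<And>x y. x \<in> S \<Longrightarrow> y \<in> S \<Longrightarrow> x \<noteq> y \<Longrightarrow> 1 / 2 < M x y" for S
  proof (rule self_similar_packing[where mul = "(\<otimes>\<^bsub>heisenberg n\<^esub>)" and X = ?X and e = ?e
        and dil = "dilation ((1 / 8) powr (1 / \<beta>))" and M = M and S = S and A = ?A])
    fix k T
    assume T: "finite T" "T \<subseteq> ?X" "\<And>x. x \<in> T \<Longrightarrow> M ?e x \<le> 2"
      "\<And>x y. x \<in> T \<Longrightarrow> y \<in> T \<Longrightarrow> x \<noteq> y \<Longrightarrow> 1 / 8 ^ k \<le> M x y"
    have R_bound: "cmod (siegel n ?e x) \<le> R" if "x \<in> T" for x
    proof -
      have "\<epsilon> * cmod (siegel n ?e x) powr \<beta> \<le> 2\<^sup>2"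
        using lower[of ?e x] power_mono[OF T(3)[OF that], of 2] by (simp add: M_def)
      then have "cmod (siegel n ?e x) powr \<beta> \<le> 4 / \<epsilon>" using \<epsilon> by (simp add: field_simps)
      then have "(cmod (siegel n ?e x) powr \<beta>) powr (1 / \<beta>) \<le> R"
        unfolding R_def using \<beta> by (intro powr_mono2) auto
      then show ?thesis using \<beta> by (simp add: powr_powr)
    qed
    have e: "fst ?e = (\<lambda>_. 0)" "snd ?e = 0" by (auto simp: heisenberg_def)
    have "real (card T) \<le> (4 * (8 * real n + 1) * R\<^sup>2 / (1 / 4096 ^ k)) ^ (2 * n + 1)"
    proof (rule siegel_separated_card_le[OF R])
      fix x assume x: "x \<in> T"
      show "\<bar>snd x\<bar> \<le> R"
        using R_bound[OF x] abs_Im_le_cmod[of "siegel n ?e x"] by (simp add: siegel_def e)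
      fix j assume j: "j \<in> {1..n}"
      have "(cmod (fst x j))\<^sup>2 \<le> (\<Sum>j=1..n. (cmod (fst x j))\<^sup>2)"
        using j by (intro member_le_sum) auto
      also have "\<dots> \<le> R"
        using R_bound[OF x] abs_Re_le_cmod[of "siegel n ?e x"] by (simp add: siegel_def e)
      also have "R \<le> R\<^sup>2" using R by (simp add: power2_eq_square)
      finally show "cmod (fst x j) \<le> R" by (rule power2_le_imp_le) (use R in simp)
    next
      fix x y assume xy: "x \<in> T" "y \<in> T" "x \<noteq> y"
      \<comment> \<open>Below 1, the exponent \<open>\<beta>\<close> may be lowered to
        \<open>1 / 2\<close>; this makes the separation independent of
        \<open>\<epsilon>\<close>.\<close>
      show "1 / 4096 ^ k \<le> cmod (siegel n x y)"
      proof (rule ccontr)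
        assume "\<not> 1 / 4096 ^ k \<le> cmod (siegel n x y)"
        then have lt: "cmod (siegel n x y) < 1 / 4096 ^ k" by simp
        also have "(1::real) / 4096 ^ k \<le> 1" by (simp add: field_simps)
        finally have le1: "cmod (siegel n x y) \<le> 1" by simp
        have "(1 / 8 ^ k)\<^sup>2 \<le> (M x y)\<^sup>2" using T(4)[OF xy] by (intro power_mono) auto
        also have "\<dots> \<le> cmod (siegel n x y) powr \<beta>" by (rule upper)
        also have "\<dots> \<le> cmod (siegel n x y) powr (1 / 2)"
          using le1 \<beta> by (intro powr_mono') auto
        also have "\<dots> = sqrt (cmod (siegel n x y))" by (simp add: powr_half_sqrt)
        also have "\<dots> < sqrt (1 / 4096 ^ k)" using lt by (rule real_sqrt_less_mono)
        also have "(1::real) / 4096 ^ k = ((1 / 8 ^ k)\<^sup>2)\<^sup>2"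
          using swap[of 8 4 k] by (simp add: power_one_over power4_eq_xxxx power2_eq_square)
        also have "sqrt (((1 / 8 ^ k)\<^sup>2)\<^sup>2) = (1 / 8 ^ k)\<^sup>2"
          by (simp only: real_sqrt_abs) simp
        finally show False by simp
      qed
    qed (simp_all add: field_simps)
    also have "4 * (8 * real n + 1) * R\<^sup>2 / (1 / 4096 ^ k) = 4 * (8 * real n + 1) * R\<^sup>2 * 4096 ^ k"
      by simp
    also have "(4 * (8 * real n + 1) * R\<^sup>2 * 4096 ^ k) ^ (2 * n + 1) = ?A * (4096 ^ k) ^ (2 * n + 1)"
      by (rule power_mult_distrib)
    also have "((4096::real) ^ k) ^ (2 * n + 1) = (4096 ^ (2 * n + 1)) ^ k"
      by (rule swap)
    finally show "real (card T) \<le> ?A * (4096 ^ (2 * n + 1)) ^ k" .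
  next
    show "dilation ((1 / 8) powr (1 / \<beta>)) ?e = ?e"
      by (simp add: dilation_def heisenberg_def)
  next
    show "M (dilation ((1 / 8) powr (1 / \<beta>)) x) (dilation ((1 / 8) powr (1 / \<beta>)) y) = M x y / 8" for x y
      using M_dil[of "1 / 8" x y] by simp
    show "M x y = M y x" "M x z \<le> M x y + M y z"
      "M (g \<otimes>\<^bsub>heisenberg n\<^esub> x) (g \<otimes>\<^bsub>heisenberg n\<^esub> y) = M x y" for x y z g
      by (fact M_sym M_tri M_mult)+
    show "finite S" "S \<subseteq> ?X" by (fact S)+
    show "M ?e x \<le> 1" if "x \<in> S" for x
      by (fact S(3)[OF that])
    show "1 / 2 < M x y" if "x \<in> S" "y \<in> S" "x \<noteq> y" for x y
      by (fact S(4)[OF that])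
  qed (simp_all add: dilation_carrier)
  interpret F: Metric_space "f ` ?X" dist
    by unfold_locales (auto simp: dist_commute dist_triangle)
  show ?thesis
  proof (rule F.doubling_if_packing_bound)
    fix c S and r :: real
    assume c: "c \<in> f ` ?X" and r: "0 < r" and S: "finite S" "S \<subseteq> F.mcball c r"
      "\<And>y z. y \<in> S \<Longrightarrow> z \<in> S \<Longrightarrow> y \<noteq> z \<Longrightarrow> r / 2 < dist y z"
    obtain x where x: "x \<in> ?X" "c = f x" using c by blast
    have "S \<subseteq> f ` ?X" using S(2) by auto
    then obtain U where U: "U \<subseteq> ?X" "inj_on f U" "S = f ` U"
      using subset_image_inj by metis
    \<comment> \<open>Translation and dilation carry the ball of radius \<open>r\<close> at
      \<open>x\<close> to the unit ball at the identity.\<close>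
    define h where "h y = dilation ((1 / r) powr (1 / \<beta>)) (inv\<^bsub>heisenberg n\<^esub> x \<otimes>\<^bsub>heisenberg n\<^esub> y)" for y
    have h: "M (h y) (h z) = M y z / r" for y z
      using M_dil[of "1 / r"] r by (simp add: h_def M_mult)
    have hx: "h x = ?e"
      using x(1) by (simp add: h_def) (simp add: dilation_def heisenberg_def)
    have "M ?e (h y) \<le> 1" if "y \<in> U" for y
    proof -
      have "dist (f x) (f y) \<le> r" using S(2) U(3) that x(2) by auto
      then show ?thesis using r unfolding hx[symmetric] h by (simp add: M_def dist_norm)
    qed
    moreover have sep: "1 / 2 < M (h y) (h z)" if "y \<in> U" "z \<in> U" "y \<noteq> z" for y z
    proof -
      have "r / 2 < dist (f y) (f z)"
        using S(3)[of "f y" "f z"] U that by (auto simp: inj_on_def)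
      then show ?thesis using r unfolding h by (simp add: M_def dist_norm field_simps)
    qed
    moreover have "inj_on h U"
      using sep by (intro inj_onI) (force simp: M_def)
    moreover have "h ` U \<subseteq> ?X"
      using U(1) x(1) by (auto simp: h_def intro!: dilation_carrier H.m_closed)
    moreover have "finite U" using S(1) U by (simp add: finite_image_iff)
    ultimately have "real (card (h ` U)) \<le> 4096 ^ (2 * n + 1)"
      by (intro packing) blast+
    then show "real (card S) \<le> 4096 ^ (2 * n + 1)"
      using U \<open>inj_on h U\<close> by (simp add: card_image)
  qed
qed

theorem theorem1p3:
  "\<exists>C::real. C > 0 \<and>
    (\<forall>\<epsilon>::real. 0 < \<epsilon> \<and> \<epsilon> < 1 / 2 \<longrightarrow>
      (\<forall>n::nat. n \<ge> 1 \<longrightarrow>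
        (\<exists>f :: (nat \<Rightarrow> complex) \<times> real \<Rightarrow> ell2.
          (\<forall>x\<in>carrier (heisenberg n). \<forall>y\<in>carrier (heisenberg n).
            sqrt \<epsilon> * koranyi_dist n x y powr (1 - \<epsilon>) \<le> norm (f x - f y) \<and>
            norm (f x - f y) \<le> koranyi_dist n x y powr (1 - \<epsilon>)) \<and>
          Metric_space.doubling_constant_at_most (f ` carrier (heisenberg n)) dist
            (exp (C * real n)))))"
proof (intro exI[of _ "3 * ln 4096"] conjI allI impI)
  show "0 < 3 * ln (4096::real)" by simp
  fix \<epsilon> :: real and n :: nat
  assume \<epsilon>: "0 < \<epsilon> \<and> \<epsilon> < 1 / 2" and n: "1 \<le> n"
  obtain f :: "(nat \<Rightarrow> complex) \<times> real \<Rightarrow> ell2"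
    where f: "\<And>x y. norm (f x - f y) = sqrt (Re (siegel n x y powr of_real (1 - \<epsilon>)))"
    using siegel_powr_embedding[of "1 - \<epsilon>" n] \<epsilon> by auto
  let ?X = "carrier (heisenberg n)"
  interpret F: Metric_space "f ` ?X" dist
    by unfold_locales (auto simp: dist_commute dist_triangle)
  show "\<exists>f :: (nat \<Rightarrow> complex) \<times> real \<Rightarrow> ell2.
          (\<forall>x\<in>?X. \<forall>y\<in>?X.
            sqrt \<epsilon> * koranyi_dist n x y powr (1 - \<epsilon>) \<le> norm (f x - f y) \<and>
            norm (f x - f y) \<le> koranyi_dist n x y powr (1 - \<epsilon>)) \<and>
          Metric_space.doubling_constant_at_most (f ` ?X) dist (exp (3 * ln 4096 * real n))"
  proof (intro exI[of _ f] conjI ballI)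
    fix x y assume xy: "x \<in> ?X" "y \<in> ?X"
    \<comment> \<open>With the distance written as \<open>sqrt (cmod \<psi>)\<close>, both estimates
      are square roots of \<open>Re_powr_bounds\<close>; hence the constant
      \<open>sqrt \<epsilon>\<close>.\<close>
    have eq: "koranyi_dist n x y powr (1 - \<epsilon>) = sqrt (cmod (siegel n x y) powr (1 - \<epsilon>))"
      unfolding koranyi_dist_eq[OF xy] by (simp add: powr_half_sqrt[symmetric] powr_powr mult.commute)
    show "sqrt \<epsilon> * koranyi_dist n x y powr (1 - \<epsilon>) \<le> norm (f x - f y)"
      "norm (f x - f y) \<le> koranyi_dist n x y powr (1 - \<epsilon>)"
      using Re_powr_bounds[of \<epsilon> "siegel n x y"] \<epsilon> siegel_Re_nonneg[of n x y]
      unfolding eq f real_sqrt_mult[symmetric] by auto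
  next
    \<comment> \<open>\<open>1 \<le> n\<close> gives \<open>2 * n + 1 \<le> 3 * n\<close>, the
      source of the constant \<open>3 * ln 4096\<close>.\<close>
    have "(4096::real) ^ (2 * n + 1) \<le> 4096 ^ (3 * n)"
      using n by (intro power_increasing) auto
    also have "\<dots> = exp (3 * ln 4096 * real n)"
      using exp_of_nat_mult[of "3 * n" "ln (4096::real)"] by (simp add: mult_ac)
    finally have "(4096::real) ^ (2 * n + 1) \<le> exp (3 * ln 4096 * real n)" .
    with doubling_siegel_powr_embedding[of \<epsilon> f n] f \<epsilon>
    show "F.doubling_constant_at_most (exp (3 * ln 4096 * real n))"
      unfolding F.doubling_constant_at_most_def by (meson order_trans)
  qed
qed

end
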